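(* Let $I$ be an ideal in $\mathbf{k}[x]$. Suppose there exists a weight vector $\alpha\in(\mathbb{N}_{>0})^n$ such that $I$ is $\alpha$-homogeneous. Then $$\mathcal{E}(\hat O I,\mathcal{U}_{\mathrm{loc}})=\mathcal{E}(I,\mathcal{U}_{\mathrm{loc}})\cap S_{\hat O}.$$
   Context: Fix $n\ge 1$, a field $\mathbf{k}$ and $x=(x_1,\dots,x_n)$; $\hat O=\mathbf{k}[[x]]$; $\mathcal{U}_{\mathrm{loc}}=\{u\in\mathbb{R}^n:u_i\le0\ \forall i\}$. $I$ is $\alpha$-homogeneous if it is generated by polynomials each of which has all its monomials $x^a$ with the same value of $\alpha\cdot a$. For $\mathcal{C}\in\{\mathbf{k}[x],\hat O\}$, $u\in\mathcal{U}_{\mathrm{loc}}$ and nonzero $f=\sum c_ax^a\in\mathcal{C}$, $\mathrm{ord}^u(f)=\max\{u\cdot a:c_a\ne0\}$, $F^u_m=\{f:\mathrm{ord}^u(f)\le m\}$, $\mathrm{gr}^u(\mathcal{C})=\bigoplus_mF^u_m/F^u_{<m}$, $\mathrm{in}_u(f)$ is the class of $f$ in $F^u_m/F^u_{<m}$ with $m=\mathrm{ord}^u(f)$ (the sum of the terms of maximal $u$-weight; $\mathrm{in}_u(0)=0$), and for an ideal $J\subset\mathcal{C}$, $\mathrm{in}_u(J)$ is the ideal of $\mathrm{gr}^u(\mathcal{C})$ generated by all $\mathrm{in}_u(f)$, $f\in J$. One identifies $\mathrm{gr}^u(\mathbf{k}[x])=\mathbf{k}[x]$ for every $u$, and $\mathrm{gr}^u(\hat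 O)=\mathbf{k}[[x_i:u_i=0]][x_i:u_i\ne0]$. For an ideal $J\subset\mathcal{C}$, $u\sim u'$ iff $\mathrm{gr}^u(\mathcal{C})=\mathrm{gr}^{u'}(\mathcal{C})$ and $\mathrm{in}_u(J)=\mathrm{in}_{u'}(J)$; $\mathcal{E}(J,\mathcal{U}_{\mathrm{loc}})$ is the set of equivalence classes on $\mathcal{U}_{\mathrm{loc}}$. The condition on graded rings is empty for $\mathcal{C}=\mathbf{k}[x]$, and for $\mathcal{C}=\hat O$ it means $\{i:u_i\ne0\}=\{i:u'_i\neq0\}$. $S_{\hat O}$ is the stratification of $\mathcal{U}_{\mathrm{loc}}$ given by the graded rings, i.e. the set of the $2^n$ strata $\{u\in\mathcal{U}_{\mathrm{loc}}:\{i:u_i\ne0\}=T\}$, $T\subset\{1,\dots,n\}$. $\mathcal{E}(I,\mathcal{U}_{\mathrm{loc}})\cap S_{\hat O}$ denotes the common refinement: the set of all nonempty intersections $C\cap S$ with $C\in\mathcal{E}(I,\mathcal{U}_{\mathrm{loc}})$ and $S\in S_{\hat O}$. *)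

theory Defs
  imports "HOL-Algebra.Subrings" "HOL-Analysis.Finite_Cartesian_Product"
begin

(* The variables are indexed by a finite type 'n.  A formal series sum_a c_a x^a is its
   coefficient function a |-> c_a, and a polynomial is a series with finite support, so that
   k[x] is literally a subring of k[[x]]. *)

definition supp :: "(nat ^ 'n \<Rightarrow> 'k::zero) \<Rightarrow> (nat ^ 'n) set" where
  "supp f = {a. f a \<noteq> 0}"

definition mfps_ring :: "(nat ^ 'n::finite \<Rightarrow> 'k::field) ring" where
  "mfps_ring = \<lparr>carrier = UNIV,
     monoid.mult = (\<lambda>f g a. \<Sum>(b, c)\<in>{(b, c). b + c = a}. f b * g c),
     one = (\<lambda>a. if a = 0 then 1 else 0),
     zero = (\<lambda>a. 0),
     add = (\<lambda>f g a. f a + g a)\<rparr>"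

definition mpoly_ring :: "(nat ^ 'n::finite \<Rightarrow> 'k::field) ring" where
  "mpoly_ring = mfps_ring\<lparr>carrier := {f. finite (supp f)}\<rparr>"

definition U_loc :: "(real ^ 'n::finite) set" where
  "U_loc = {u. \<forall>i. u $ i \<le> 0}"

definition weight :: "real ^ 'n::finite \<Rightarrow> nat ^ 'n \<Rightarrow> real" where
  "weight u a = (\<Sum>i\<in>UNIV. u $ i * real (a $ i))"

(* Meaningful only for f \<noteq> 0.  For u in U_loc the greatest element exists even if the
   support of f is infinite. *)
definition u_ord :: "real ^ 'n::finite \<Rightarrow> (nat ^ 'n \<Rightarrow> 'k::zero) \<Rightarrow> real" where
  "u_ord u f = (GREATEST m. m \<in> weight u ` supp f)"

(* The quotient F_m / F_{<m} is identified with the elements of C all of whose monomials have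
   u-weight m (each class has exactly one such representative), so the direct sum over m
   consists of the elements of C whose monomials have only finitely many different weights. *)
definition gr_ring ::
  "(nat ^ 'n::finite \<Rightarrow> 'k::field) ring \<Rightarrow> real ^ 'n \<Rightarrow> (nat ^ 'n \<Rightarrow> 'k) ring" where
  "gr_ring C u = C\<lparr>carrier := {f \<in> carrier C. finite (weight u ` supp f)}\<rparr>"

definition in_form :: "real ^ 'n::finite \<Rightarrow> (nat ^ 'n \<Rightarrow> 'k::zero) \<Rightarrow> (nat ^ 'n \<Rightarrow> 'k)" where
  "in_form u f = (\<lambda>a. if a \<in> supp f \<and> weight u a = u_ord u f then f a else 0)"

definition in_ideal ::
  "(nat ^ 'n::finite \<Rightarrow> 'k::field) ring \<Rightarrow> real ^ 'n \<Rightarrow> (nat ^ 'n \<Rightarrow> 'k) set \<Rightarrow> (nat ^ 'n \<Rightarrow> 'k) set"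
  where "in_ideal C u J = Idl\<^bsub>gr_ring C u\<^esub> (in_form u ` J)"

definition in_equiv ::
  "(nat ^ 'n::finite \<Rightarrow> 'k::field) ring \<Rightarrow> (nat ^ 'n \<Rightarrow> 'k) set \<Rightarrow> (real ^ 'n) rel" where
  "in_equiv C J = {(u, u'). u \<in> U_loc \<and> u' \<in> U_loc \<and>
     gr_ring C u = gr_ring C u' \<and> in_ideal C u J = in_ideal C u' J}"

definition in_classes ::
  "(nat ^ 'n::finite \<Rightarrow> 'k::field) ring \<Rightarrow> (nat ^ 'n \<Rightarrow> 'k) set \<Rightarrow> (real ^ 'n) set set" where
  "in_classes C J = U_loc // in_equiv C J"

definition strata :: "(real ^ 'n::finite) set set" where
  "strata = range (\<lambda>T. {u \<in> U_loc. {i. u $ i \<noteq> 0} = T})"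

definition common_refinement :: "'a set set \<Rightarrow> 'a set set \<Rightarrow> 'a set set" where
  "common_refinement P Q = {A \<inter> B | A B. A \<in> P \<and> B \<in> Q \<and> A \<inter> B \<noteq> {}}"

definition homogeneous_poly :: "nat ^ 'n::finite \<Rightarrow> (nat ^ 'n \<Rightarrow> 'k::zero) \<Rightarrow> bool" where
  "homogeneous_poly \<alpha> g \<longleftrightarrow> (\<exists>d. \<forall>a\<in>supp g. (\<Sum>i\<in>UNIV. \<alpha> $ i * a $ i) = d)"

definition homogeneous_ideal :: "nat ^ 'n::finite \<Rightarrow> (nat ^ 'n \<Rightarrow> 'k::field) set \<Rightarrow> bool" where
  "homogeneous_ideal \<alpha> I \<longleftrightarrow>
     (\<exists>G \<subseteq> carrier mpoly_ring. (\<forall>g\<in>G. homogeneous_poly \<alpha> g) \<and> I = Idl\<^bsub>mpoly_ring\<^esub> G)"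

lemma finite_vec_le: "finite {b :: nat ^ 'n::finite. \<forall>i. b $ i \<le> B i}"
proof (rule finite_subset)
  show "{b :: nat ^ 'n. \<forall>i. b $ i \<le> B i} \<subseteq> vec_lambda ` (PiE UNIV (\<lambda>i. {..B i}))"
  proof
    fix b :: "nat ^ 'n" assume "b \<in> {b. \<forall>i. b $ i \<le> B i}"
    then have "vec_nth b \<in> PiE UNIV (\<lambda>i. {..B i})" by auto
    then show "b \<in> vec_lambda ` (PiE UNIV (\<lambda>i. {..B i}))"
      by (metis image_eqI vec_nth_inverse)
  qed
  show "finite (vec_lambda ` (PiE (UNIV :: 'n set) (\<lambda>i. {..B i})))"
    by (intro finite_imageI finite_PiE) auto
qed

lemma finite_sum_pairs: "finite {(b, c). b + c = (a :: nat ^ 'n::finite)}"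
proof (rule finite_subset)
  show "{(b, c). b + c = a} \<subseteq> {b. \<forall>i. b $ i \<le> a $ i} \<times> {b. \<forall>i. b $ i \<le> a $ i}"
    by auto
  show "finite ({b. \<forall>i. b $ i \<le> a $ i} \<times> {b. \<forall>i. b $ i \<le> a $ i})"
    by (intro finite_cartesian_product finite_vec_le)
qed

lemma mfps_cring: "cring (mfps_ring :: (nat ^ 'n::finite \<Rightarrow> 'k::field) ring)"
proof -
  let ?R = "mfps_ring :: (nat ^ 'n \<Rightarrow> 'k) ring"
  have comm: "f \<otimes>\<^bsub>?R\<^esub> g = g \<otimes>\<^bsub>?R\<^esub> f" for f g
    unfolding mfps_ring_def
    by (auto intro!: ext sum.reindex_bij_witness[where i = prod.swap and j = prod.swap]
        simp: add.commute mult.commute)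
  have assoc: "(f \<otimes>\<^bsub>?R\<^esub> g) \<otimes>\<^bsub>?R\<^esub> h = f \<otimes>\<^bsub>?R\<^esub> (g \<otimes>\<^bsub>?R\<^esub> h)" for f g h
  proof
    fix a
    have "((f \<otimes>\<^bsub>?R\<^esub> g) \<otimes>\<^bsub>?R\<^esub> h) a =
        (\<Sum>x\<in>{(b, c). b + c = a}. \<Sum>y\<in>{(b, c). b + c = fst x}. f (fst y) * g (snd y) * h (snd x))"
      by (simp add: mfps_ring_def case_prod_unfold sum_distrib_right)
    also have "\<dots> = (\<Sum>(x, y)\<in>Sigma {(b, c). b + c = a} (\<lambda>x. {(b, c). b + c = fst x}).
        f (fst y) * g (snd y) * h (snd x))"
      by (subst sum.Sigma) (auto simp: finite_sum_pairs)
    also have "\<dots> = (\<Sum>(x, y)\<in>Sigma {(b, c). b + c = a} (\<lambda>x. {(b, c). b + c = snd x}).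
        f (fst x) * (g (fst y) * h (snd y)))"
      by (rule sum.reindex_bij_witness[where
            i = "\<lambda>((p, s), (q, r)). ((p + q, r), (p, q))" and
            j = "\<lambda>((s, r), (p, q)). ((p, q + r), (q, r))"])
        (auto simp: add.assoc mult.assoc)
    also have "\<dots> =
        (\<Sum>x\<in>{(b, c). b + c = a}. \<Sum>y\<in>{(b, c). b + c = snd x}. f (fst x) * (g (fst y) * h (snd y)))"
      by (subst sum.Sigma) (auto simp: finite_sum_pairs)
    also have "\<dots> = (f \<otimes>\<^bsub>?R\<^esub> (g \<otimes>\<^bsub>?R\<^esub> h)) a"
      by (simp add: mfps_ring_def case_prod_unfold sum_distrib_left)
    finally show "((f \<otimes>\<^bsub>?R\<^esub> g) \<otimes>\<^bsub>?R\<^esub> h) a = (f \<otimes>\<^bsub>?R\<^esub> (g \<otimes>\<^bsub>?R\<^esub> h)) a" .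
  qed
  have one: "\<one>\<^bsub>?R\<^esub> \<otimes>\<^bsub>?R\<^esub> f = f" for f
  proof
    fix a
    have "(\<one>\<^bsub>?R\<^esub> \<otimes>\<^bsub>?R\<^esub> f) a = (\<Sum>x\<in>{(b, c). b + c = a}. (if fst x = 0 then 1 else 0) * f (snd x))"
      by (simp add: mfps_ring_def case_prod_unfold)
    also have "\<dots> = (\<Sum>x\<in>{(0 :: nat ^ 'n, a)}. (if fst x = 0 then 1 else 0) * f (snd x))"
      by (rule sum.mono_neutral_right) (auto simp: finite_sum_pairs)
    finally show "(\<one>\<^bsub>?R\<^esub> \<otimes>\<^bsub>?R\<^esub> f) a = f a" by simp
  qed
  have distr: "(f \<oplus>\<^bsub>?R\<^esub> g) \<otimes>\<^bsub>?R\<^esub> h = f \<otimes>\<^bsub>?R\<^esub> h \<oplus>\<^bsub>?R\<^esub> g \<otimes>\<^bsub>?R\<^esub> h" for f g h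
    by (simp add: mfps_ring_def case_prod_unfold distrib_right sum.distrib)
  have carr: "f \<in> carrier ?R" for f by (simp add: mfps_ring_def)
  have "abelian_group ?R"
  proof (rule abelian_groupI)
    fix f show "\<exists>g\<in>carrier ?R. g \<oplus>\<^bsub>?R\<^esub> f = \<zero>\<^bsub>?R\<^esub>"
      by (rule bexI[where x = "\<lambda>a. - f a"]) (auto simp: mfps_ring_def)
  qed (auto simp: mfps_ring_def add_ac)
  moreover have "comm_monoid ?R"
    by (rule comm_monoidI) (rule carr assoc one comm)+
  ultimately show ?thesis
    by (rule cringI) (simp add: distr)
qed

lemma supp_mult_subset:
  fixes f g :: "nat ^ 'n::finite \<Rightarrow> 'k::field"
  shows "supp (f \<otimes>\<^bsub>mfps_ring\<^esub> g) \<subseteq> (\<lambda>(b, c). b + c) ` (supp f \<times> supp g)"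
proof
  fix a assume "a \<in> supp (f \<otimes>\<^bsub>mfps_ring\<^esub> g)"
  then have "(\<Sum>(b, c)\<in>{(b, c). b + c = a}. f b * g c) \<noteq> 0"
    by (simp add: supp_def mfps_ring_def)
  then obtain x where x: "x \<in> {(b, c). b + c = a}" "(case x of (b, c) \<Rightarrow> f b * g c) \<noteq> 0"
    by (rule sum.not_neutral_contains_not_neutral)
  show "a \<in> (\<lambda>(b, c). b + c) ` (supp f \<times> supp g)"
    by (rule image_eqI[where x = x]) (use x in \<open>auto simp: supp_def\<close>)
qed

lemma weight_add: "weight u (b + c) = weight u b + weight u c"
  by (simp add: weight_def distrib_left sum.distrib)

lemma mfps_minus: "\<ominus>\<^bsub>mfps_ring\<^esub> (f :: nat ^ 'n::finite \<Rightarrow> 'k::field) = (\<lambda>a. - f a)"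
proof -
  interpret cring "mfps_ring :: (nat ^ 'n \<Rightarrow> 'k) ring" by (rule mfps_cring)
  show ?thesis by (rule minus_equality) (auto simp: mfps_ring_def)
qed

lemma finite_image_supp_subring:
  fixes w :: "nat ^ 'n::finite \<Rightarrow> 'b::comm_monoid_add"
  assumes w: "\<And>b c. w (b + c) = w b + w c"
  shows "subring {f :: nat ^ 'n \<Rightarrow> 'k::field. finite (w ` supp f)} mfps_ring"
proof -
  let ?R = "mfps_ring :: (nat ^ 'n \<Rightarrow> 'k) ring"
  interpret cring ?R by (rule mfps_cring)
  show ?thesis
  proof (rule subringI)
    show "{f. finite (w ` supp f)} \<subseteq> carrier ?R" by (simp add: mfps_ring_def)
    have "supp \<one>\<^bsub>?R\<^esub> \<subseteq> {0}" by (auto simp: supp_def mfps_ring_def)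
    then have "finite (supp \<one>\<^bsub>?R\<^esub>)" by (rule finite_subset) simp
    then show "\<one>\<^bsub>?R\<^esub> \<in> {f. finite (w ` supp f)}" by simp
    show "\<ominus>\<^bsub>?R\<^esub> f \<in> {f. finite (w ` supp f)}" if "f \<in> {f. finite (w ` supp f)}" for f
      using that by (simp add: mfps_minus supp_def)
    fix f g :: "nat ^ 'n \<Rightarrow> 'k"
    assume fg: "f \<in> {f. finite (w ` supp f)}" "g \<in> {f. finite (w ` supp f)}"
    have "w ` supp (f \<otimes>\<^bsub>?R\<^esub> g) \<subseteq> (\<lambda>(b, c). b + c) ` (w ` supp f \<times> w ` supp g)"
    proof
      fix y assume "y \<in> w ` supp (f \<otimes>\<^bsub>?R\<^esub> g)"
      then obtain a where a: "a \<in> supp (f \<otimes>\<^bsub>?R\<^esub> g)" "y = w a" by (rule imageE)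
      from subsetD[OF supp_mult_subset a(1)] obtain b c
        where bc: "b \<in> supp f" "c \<in> supp g" "a = b + c" by clarsimp
      show "y \<in> (\<lambda>(b, c). b + c) ` (w ` supp f \<times> w ` supp g)"
        by (rule image_eqI[where x = "(w b, w c)"]) (use a(2) bc in \<open>simp_all add: w\<close>)
    qed
    moreover have "finite ((\<lambda>(b, c). b + c) ` (w ` supp f \<times> w ` supp g))"
      using fg by simp
    ultimately have "finite (w ` supp (f \<otimes>\<^bsub>?R\<^esub> g))"
      by (rule finite_subset)
    then show "f \<otimes>\<^bsub>?R\<^esub> g \<in> {f. finite (w ` supp f)}" by simp
    have "supp (f \<oplus>\<^bsub>?R\<^esub> g) \<subseteq> supp f \<union> supp g"
      by (auto simp: supp_def mfps_ring_def)
    then have "w ` supp (f \<oplus>\<^bsub>?R\<^esub> g) \<subseteq> w ` supp f \<union> w ` supp g"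
      by blast
    moreover have "finite (w ` supp f \<union> w ` supp g)"
      using fg by simp
    ultimately have "finite (w ` supp (f \<oplus>\<^bsub>?R\<^esub> g))"
      by (rule finite_subset)
    then show "f \<oplus>\<^bsub>?R\<^esub> g \<in> {f. finite (w ` supp f)}" by simp
  qed
qed

lemma mpoly_subring: "subring (carrier mpoly_ring) (mfps_ring :: (nat ^ 'n::finite \<Rightarrow> 'k::field) ring)"
  using finite_image_supp_subring[of "\<lambda>a. a"] by (simp add: mpoly_ring_def)

lemma mpoly_cring: "cring (mpoly_ring :: (nat ^ 'n::finite \<Rightarrow> 'k::field) ring)"
proof -
  interpret cring "mfps_ring :: (nat ^ 'n \<Rightarrow> 'k) ring" by (rule mfps_cring)
  have eq: "mpoly_ring = (mfps_ring :: (nat ^ 'n \<Rightarrow> 'k) ring)\<lparr>carrier := carrier mpoly_ring\<rparr>"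
    by (simp add: mpoly_ring_def)
  show ?thesis
    by (subst eq)
      (rule subcring_iff[THEN iffD1, OF subringE(1)[OF mpoly_subring] subcringI'[OF mpoly_subring]])
qed

lemma gr_mpoly: "gr_ring mpoly_ring u = (mpoly_ring :: (nat ^ 'n::finite \<Rightarrow> 'k::field) ring)"
proof -
  have "{f \<in> carrier mpoly_ring. finite (weight u ` supp f)} =
      carrier (mpoly_ring :: (nat ^ 'n \<Rightarrow> 'k) ring)"
    by (auto simp: mpoly_ring_def)
  then show ?thesis by (simp add: gr_ring_def)
qed

lemma gr_mfps_cring: "cring (gr_ring (mfps_ring :: (nat ^ 'n::finite \<Rightarrow> 'k::field) ring) u)"
proof -
  interpret cring "mfps_ring :: (nat ^ 'n \<Rightarrow> 'k) ring" by (rule mfps_cring)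
  have eq: "gr_ring mfps_ring u =
      (mfps_ring :: (nat ^ 'n \<Rightarrow> 'k) ring)\<lparr>carrier := {f. finite (weight u ` supp f)}\<rparr>"
    by (simp add: gr_ring_def mfps_ring_def)
  have sub: "subring {f :: nat ^ 'n \<Rightarrow> 'k. finite (weight u ` supp f)} mfps_ring"
    by (rule finite_image_supp_subring) (rule weight_add)
  show ?thesis
    unfolding eq by (rule subcring_iff[THEN iffD1, OF subringE(1)[OF sub] subcringI'[OF sub]])
qed

(* The series in k[[x_i : u_i = 0]][x_i : u_i \<noteq> 0] are those in whose monomials only
   finitely many different exponents of (x_i : u_i \<noteq> 0) occur. *)
lemma gr_mfps_carrier:
  fixes u :: "real ^ 'n::finite"
  assumes "u \<in> U_loc"
  shows "carrier (gr_ring (mfps_ring :: (nat ^ 'n \<Rightarrow> 'k::field) ring) u) =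
    {f. finite ((\<lambda>a. \<chi> i. if u $ i \<noteq> 0 then a $ i else 0) ` supp f)}"
proof -
  define r where "r = (\<lambda>a :: nat ^ 'n. (\<chi> i. if u $ i \<noteq> 0 then a $ i else 0) :: nat ^ 'n)"
  have wr: "weight u (r a) = weight u a" for a
    unfolding weight_def r_def by (rule sum.cong) auto
  have "finite (weight u ` supp f) \<longleftrightarrow> finite (r ` supp f)" for f :: "nat ^ 'n \<Rightarrow> 'k"
  proof
    assume "finite (r ` supp f)"
    then have "finite (weight u ` r ` supp f)" by (rule finite_imageI)
    then show "finite (weight u ` supp f)" by (simp add: image_image wr)
  next
    assume "finite (weight u ` supp f)"
    then obtain M where M: "\<And>a. a \<in> supp f \<Longrightarrow> M \<le> weight u a"
      by (metis bdd_below_finite bdd_below.E image_eqI)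
    define B where "B i = (if u $ i \<noteq> 0 then nat \<lceil>M / u $ i\<rceil> else 0)" for i
    have "r a $ i \<le> B i" if a: "a \<in> supp f" for a i
    proof (cases "u $ i = 0")
      case False
      have neg: "u $ j * real (a $ j) \<le> 0" for j
        using assms by (simp add: U_loc_def mult_nonpos_nonneg)
      have "M \<le> weight u a" by (rule M[OF a])
      also have "\<dots> = u $ i * real (a $ i) + (\<Sum>j\<in>UNIV - {i}. u $ j * real (a $ j))"
        unfolding weight_def by (rule sum.remove) auto
      also have "\<dots> \<le> u $ i * real (a $ i)"
        using sum_nonpos[of "UNIV - {i}" "\<lambda>j. u $ j * real (a $ j)"] neg by simp
      finally have "M \<le> u $ i * real (a $ i)" .
      moreover have "u $ i < 0" using assms False by (simp add: U_loc_def less_le)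
      ultimately have "real (a $ i) \<le> M / u $ i"
        by (simp add: neg_le_divide_eq mult.commute)
      then show ?thesis using False by (simp add: r_def B_def) linarith
    qed (simp add: r_def)
    then have "r ` supp f \<subseteq> {b. \<forall>i. b $ i \<le> B i}" by auto
    then show "finite (r ` supp f)" using finite_vec_le finite_subset by blast
  qed
  then show ?thesis by (simp add: gr_ring_def mfps_ring_def r_def)
qed

lemma gr_mfps_eq_iff:
  fixes u u' :: "real ^ 'n::finite"
  assumes "u \<in> U_loc" "u' \<in> U_loc"
  shows "gr_ring (mfps_ring :: (nat ^ 'n \<Rightarrow> 'k::field) ring) u = gr_ring mfps_ring u' \<longleftrightarrow>
    {i. u $ i \<noteq> 0} = {i. u' $ i \<noteq> 0}"
proof
  let ?gr = "gr_ring (mfps_ring :: (nat ^ 'n \<Rightarrow> 'k) ring)"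
  have sub: "{i. u $ i \<noteq> 0} \<subseteq> {i. u' $ i \<noteq> 0}"
    if eq: "?gr u = ?gr u'" and U: "u \<in> U_loc" "u' \<in> U_loc" for u u' :: "real ^ 'n"
  proof (rule ccontr)
    assume "\<not> ?thesis"
    then obtain i where i: "u $ i \<noteq> 0" "u' $ i = 0" by auto
    define X where "X = range (\<lambda>m :: nat. axis i m :: nat ^ 'n)"
    define f where "f = (\<lambda>a. if a \<in> X then 1 else 0 :: 'k)"
    have supp: "supp f = X" by (auto simp: supp_def f_def)
    have "(\<lambda>a. \<chi> j. if u' $ j \<noteq> 0 then a $ j else 0) ` X \<subseteq> {0}"
      using i by (auto simp: X_def axis_def vec_eq_iff)
    then have "finite ((\<lambda>a. \<chi> j. if u' $ j \<noteq> 0 then a $ j else 0) ` supp f)"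
      unfolding supp by (rule finite_subset) simp
    then have "f \<in> carrier (?gr u')"
      unfolding gr_mfps_carrier[OF U(2)] by simp
    then have "finite ((\<lambda>a. \<chi> j. if u $ j \<noteq> 0 then a $ j else 0) ` X)"
      unfolding eq[symmetric] gr_mfps_carrier[OF U(1)] supp[symmetric] by simp
    moreover have "(\<lambda>a. \<chi> j. if u $ j \<noteq> 0 then a $ j else 0) ` X = X"
      unfolding X_def image_image using i
      by (intro image_cong) (auto simp: axis_def vec_eq_iff)
    moreover have "inj (\<lambda>m :: nat. axis i m :: nat ^ 'n)"
      by (auto simp: inj_def axis_eq_axis)
    ultimately show False unfolding X_def using finite_imageD by fastforce
  qed
  show "{i. u $ i \<noteq> 0} = {i. u' $ i \<noteq> 0}" if "?gr u = ?gr u'"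
    using sub[OF that assms] sub[OF that[symmetric] assms(2,1)] by blast
  show "?gr u = ?gr u'" if "{i. u $ i \<noteq> 0} = {i. u' $ i \<noteq> 0}"
  proof -
    have "carrier (?gr u) = carrier (?gr u')"
      using that unfolding gr_mfps_carrier[OF assms(1)] gr_mfps_carrier[OF assms(2)]
      by (simp add: set_eq_iff)
    then show ?thesis by (simp add: gr_ring_def)
  qed
qed

end

theory Submission
  imports Defs
begin

text \<open>
  Write \<open>J\<close> for the extension of \<open>I\<close> to the ring of power series. Two weights in the same
  stratum have the same graded ring, and weights in different strata have different ones. So it
  suffices to see that, within a stratum, the initial ideal of \<open>J\<close> and the initial ideal of \<open>I\<close>
  determine each other. They do so by extension and contraction: for every \<open>u\<close>, \<open>in\<^sub>u(J)\<close> is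
  the ideal of the graded ring generated by \<open>in\<^sub>u(I)\<close> (\<open>in_ideal_extension_eq_Idl\<close>), and
  \<open>in\<^sub>u(J)\<close> meets the polynomial ring exactly in \<open>in\<^sub>u(I)\<close>
  (\<open>in_ideal_extension_Int_mpoly\<close>).

  Both facts come from splitting a series into its \<open>\<alpha>\<close>-homogeneous components. Since all entries
  of \<open>\<alpha>\<close> are positive, each component is a polynomial, and the component of a product of degree
  \<open>d\<close> involves only finitely many components of the factors. Hence, for any polynomial ideal
  \<open>M\<close>, the series whose components all lie in \<open>M\<close> form an ideal (\<open>ideal_graded_hull\<close>). As
  \<open>I\<close> is \<open>\<alpha>\<close>-homogeneous, this bounds \<open>J\<close>: every component of an \<open>f \<in> J\<close> lies in
  \<open>I\<close>. Passing to components commutes with passing to initial forms, except that a component of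
  the initial form may vanish, so every component of \<open>in\<^sub>u(f)\<close> lies in \<open>in\<^sub>u(I)\<close>. A polynomial is
  the sum of its finitely many components, and this gives the contraction statement.

  For the extension statement, \<open>in\<^sub>u(f)\<close> is an infinite sum of elements of \<open>in\<^sub>u(I)\<close>, one in each
  degree, and has to be written as a finite combination of elements of \<open>in\<^sub>u(I)\<close>. The Hilbert
  basis theorem (\<open>hilbert_basis\<close>) provides finitely many generators of \<open>in\<^sub>u(I)\<close> that are
  homogeneous for \<open>\<alpha>\<close> and for \<open>u\<close>. Expressing each component by them and gluing the
  coefficients degree by degree gives power series coefficients (\<open>bihomogeneous_gluing\<close>); as
  \<open>in\<^sub>u(f)\<close> has a single \<open>u\<close>-weight, each of them may be cut down to a single \<open>u\<close>-weight and
  so belongs to the graded ring.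
\<close>

section \<open>Dickson's lemma and a monomial order\<close>

lemma nat_seq_mono_subseq:
  fixes x :: "nat \<Rightarrow> nat"
  shows "\<exists>\<phi> :: nat \<Rightarrow> nat. strict_mono \<phi> \<and> mono (x \<circ> \<phi>)"
proof -
  obtain f :: "nat \<Rightarrow> nat" where f: "strict_mono f" "monoseq (\<lambda>n. x (f n))"
    using seq_monosub[of x] by auto
  show ?thesis
  proof (cases "incseq (\<lambda>n. x (f n))")
    case True
    then have "mono (x \<circ> f)" by (simp add: mono_def)
    with f(1) show ?thesis by blast
  next
    case False
    with f(2) have dec: "x (f n) \<le> x (f m)" if "m \<le> n" for m n
      using that by (auto simp: monoseq_iff decseq_def)
    obtain N where N: "\<And>n. x (f N) \<le> x (f n)"
      using ex_has_least_nat[of "\<lambda>_. True" _ "\<lambda>n. x (f n)"] by auto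
    have "x (f (N + n)) = x (f N)" for n
      using dec[of N "N + n"] N[of "N + n"] by simp
    then have "mono (x \<circ> (\<lambda>n. f (N + n)))" by (simp add: mono_def)
    moreover have "strict_mono (\<lambda>n. f (N + n))"
      using f(1) by (simp add: strict_mono_def)
    ultimately show ?thesis by blast
  qed
qed

lemma vec_seq_mono_subseq:
  fixes s :: "nat \<Rightarrow> nat ^ 'n::finite"
  shows "\<exists>\<phi> :: nat \<Rightarrow> nat. strict_mono \<phi> \<and> mono (s \<circ> \<phi>)"
proof -
  have "\<exists>\<phi> :: nat \<Rightarrow> nat. strict_mono \<phi> \<and> (\<forall>i\<in>T. mono (\<lambda>k. s (\<phi> k) $ i))" if "finite T" for T
    using that
  proof (induction T)
    case empty
    have "strict_mono (\<lambda>k :: nat. k)" by (simp add: strict_mono_def)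
    then show ?case by blast
  next
    case (insert i T)
    then obtain \<phi> :: "nat \<Rightarrow> nat" where \<phi>: "strict_mono \<phi>" "\<forall>i\<in>T. mono (\<lambda>k. s (\<phi> k) $ i)" by auto
    obtain \<psi> :: "nat \<Rightarrow> nat" where \<psi>: "strict_mono \<psi>" "mono ((\<lambda>k. s (\<phi> k) $ i) \<circ> \<psi>)"
      using nat_seq_mono_subseq by blast
    have "strict_mono (\<phi> \<circ> \<psi>)" using \<phi>(1) \<psi>(1) by (simp add: strict_mono_def)
    moreover have "mono (\<lambda>k. s ((\<phi> \<circ> \<psi>) k) $ j)" if "j \<in> insert i T" for j
      using that \<psi>(2) \<phi>(2) strict_mono_mono[OF \<psi>(1)] by (auto simp: mono_def comp_def)
    ultimately show ?case by blast
  qed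
  from this[OF finite_class.finite_UNIV] show ?thesis
    by (auto simp: mono_def less_eq_vec_def)
qed

text \<open>
  The minimal elements of \<open>L\<close> suffice. Two distinct minimal elements are incomparable, so
  infinitely many of them would form a sequence without a nondecreasing subsequence.
\<close>
lemma dickson:
  fixes L :: "(nat ^ 'n::finite) set"
  obtains B where "B \<subseteq> L" "finite B" "\<And>a. a \<in> L \<Longrightarrow> \<exists>b\<in>B. b \<le> a"
proof -
  define B where "B = {b \<in> L. \<forall>a\<in>L. a \<le> b \<longrightarrow> a = b}"
  have "finite B"
  proof (rule ccontr)
    assume "infinite B"
    then obtain s :: "nat \<Rightarrow> nat ^ 'n" where s: "inj s" "range s \<subseteq> B"
      using infinite_countable_subset by blast
    obtain \<phi> :: "nat \<Rightarrow> nat" where \<phi>: "strict_mono \<phi>" "mono (s \<circ> \<phi>)"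
      using vec_seq_mono_subseq by blast
    have "s (\<phi> 0) \<le> s (\<phi> 1)" using \<phi>(2) by (simp add: mono_def)
    moreover have "s (\<phi> 0) \<in> B" "s (\<phi> 1) \<in> B" using s(2) by auto
    ultimately have "s (\<phi> 0) = s (\<phi> 1)" by (simp add: B_def)
    then have "\<phi> 0 = \<phi> 1" using s(1) by (simp add: inj_eq)
    then show False using \<phi>(1) by (simp add: strict_mono_eq)
  qed
  moreover have "\<exists>b\<in>B. b \<le> a" if "a \<in> L" for a
    using that
  proof (induction "\<Sum>i\<in>UNIV. a $ i" arbitrary: a rule: less_induct)
    case less
    show ?case
    proof (cases "a \<in> B")
      case False
      then obtain c where c: "c \<in> L" "c \<le> a" "c \<noteq> a" using less.prems by (auto simp: B_def)
      have "(\<Sum>i\<in>UNIV. c $ i) < (\<Sum>i\<in>UNIV. a $ i)"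
      proof (rule sum_strict_mono_ex1)
        show "\<forall>i\<in>UNIV. c $ i \<le> a $ i" using c(2) by (simp add: less_eq_vec_def)
        then show "\<exists>i\<in>UNIV. c $ i < a $ i"
          using c(3) by (auto simp: vec_eq_iff order.strict_iff_order)
      qed simp
      from less.hyps[OF this c(1)] show ?thesis using c(2) order_trans by blast
    qed auto
  qed
  ultimately show ?thesis using that[of B] by (auto simp: B_def)
qed

text \<open>
  The lexicographic order for an arbitrary enumeration of the variables has all four properties.
\<close>
lemma monomial_order_exists:
  obtains r :: "(nat ^ 'n::finite) rel"
  where "wf r" "trans r" "total r" "\<And>a b c. (a, b) \<in> r \<Longrightarrow> (c + a, c + b) \<in> r"
proof -
  obtain l :: "'n list" where l: "set l = UNIV"
    using finite_list[OF finite_class.finite_UNIV] by blast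
  define r :: "(nat ^ 'n) rel" where
    "r = inv_image (lex less_than) (\<lambda>a. map (vec_nth a) l)"
  have "wf r" unfolding r_def by (intro wf_inv_image wf_lex wf_less_than)
  moreover have "trans r"
  proof (rule transI)
    fix a b c :: "nat ^ 'n"
    have "(map (vec_nth a) k, map (vec_nth b) k) \<in> lex less_than \<Longrightarrow>
        (map (vec_nth b) k, map (vec_nth c) k) \<in> lex less_than \<Longrightarrow>
        (map (vec_nth a) k, map (vec_nth c) k) \<in> lex less_than" for k
      by (induction k) auto
    then show "(a, b) \<in> r \<Longrightarrow> (b, c) \<in> r \<Longrightarrow> (a, c) \<in> r" by (simp add: r_def)
  qed
  moreover have "total r"
  proof (rule totalI)
    fix a b :: "nat ^ 'n" assume "a \<noteq> b"
    then have "map (vec_nth a) l \<noteq> map (vec_nth b) l" using l by (auto simp: vec_eq_iff)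
    moreover have "map (vec_nth a) k \<noteq> map (vec_nth b) k \<Longrightarrow>
        (map (vec_nth a) k, map (vec_nth b) k) \<in> lex less_than \<or>
        (map (vec_nth b) k, map (vec_nth a) k) \<in> lex less_than" for k
      by (induction k) auto
    ultimately show "(a, b) \<in> r \<or> (b, a) \<in> r" by (simp add: r_def)
  qed
  moreover have "(c + a, c + b) \<in> r" if "(a, b) \<in> r" for a b c
  proof -
    have "(map (vec_nth a) k, map (vec_nth b) k) \<in> lex less_than \<Longrightarrow>
        (map (vec_nth (c + a)) k, map (vec_nth (c + b)) k) \<in> lex less_than" for k
      by (induction k) auto
    then show ?thesis using that by (simp add: r_def)
  qed
  ultimately show ?thesis using that by blast
qed

lemma finite_has_greatest:
  assumes "trans r" "total r" "finite A" "A \<noteq> {}"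
  obtains a where "a \<in> A" "\<And>b. b \<in> A \<Longrightarrow> b = a \<or> (b, a) \<in> r"
proof -
  have "\<exists>a\<in>A. \<forall>b\<in>A. b = a \<or> (b, a) \<in> r"
    using assms(3,4)
  proof (induction rule: finite_ne_induct)
    case (insert x F)
    then obtain a where a: "a \<in> F" "\<forall>b\<in>F. b = a \<or> (b, a) \<in> r" by blast
    have "x = a \<or> (x, a) \<in> r \<or> (a, x) \<in> r" using assms(2) by (auto simp: total_on_def)
    then show ?case
    proof (elim disjE)
      assume "(a, x) \<in> r"
      then have "\<forall>b\<in>insert x F. b = x \<or> (b, x) \<in> r"
        using a(2) by (auto dest: transD[OF assms(1)])
      then show ?thesis by blast
    qed (use a in blast)+
  qed simp
  then show ?thesis using that by blast
qed

section \<open>Rings of formal series\<close>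

text \<open>
  The polynomials, the power series and the graded rings share the operations of the ring of power
  series and differ in their carriers only. Working with an arbitrary subring \<open>K\<close> treats the three
  cases at once.
\<close>
abbreviation series_ring :: "(nat ^ 'n::finite \<Rightarrow> 'k::field) set \<Rightarrow> (nat ^ 'n \<Rightarrow> 'k) ring" where
  "series_ring K \<equiv> mfps_ring\<lparr>carrier := K\<rparr>"

abbreviation times_series ::
  "(nat ^ 'n::finite \<Rightarrow> 'k::field) \<Rightarrow> (nat ^ 'n \<Rightarrow> 'k) \<Rightarrow> nat ^ 'n \<Rightarrow> 'k" (infixl "\<star>" 70) where
  "f \<star> g \<equiv> f \<otimes>\<^bsub>mfps_ring\<^esub> g"

lemma times_apply: "(f \<star> g) a = (\<Sum>(b, c)\<in>{(b, c). b + c = a}. f b * g c)"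
  by (simp add: mfps_ring_def)

lemma series_ring_simps:
  "\<zero>\<^bsub>mfps_ring\<^esub> = (\<lambda>a. 0)" "f \<oplus>\<^bsub>mfps_ring\<^esub> g = (\<lambda>a. f a + g a)"
  by (simp_all add: mfps_ring_def)

lemma mfps_ring_eq: "mfps_ring = series_ring UNIV"
  and mpoly_ring_eq: "mpoly_ring = series_ring {f. finite (supp f)}"
  and gr_mfps_eq: "gr_ring mfps_ring u = series_ring {f. finite (weight u ` supp f)}"
  by (simp_all add: mfps_ring_def mpoly_ring_def gr_ring_def)

lemma mpoly_carrier: "carrier mpoly_ring = {f. finite (supp f)}"
  by (simp add: mpoly_ring_def)

lemma subring_UNIV: "subring UNIV (mfps_ring :: (nat ^ 'n::finite \<Rightarrow> 'k::field) ring)"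
proof -
  interpret cring "mfps_ring :: (nat ^ 'n \<Rightarrow> 'k) ring" by (rule mfps_cring)
  show ?thesis using carrier_is_subring by (simp add: mfps_ring_def)
qed

lemma subring_finite_supp:
  "subring {f :: nat ^ 'n::finite \<Rightarrow> 'k::field. finite (supp f)} mfps_ring"
  using finite_image_supp_subring[of "\<lambda>a. a"] by simp

lemma subring_gr:
  "subring {f :: nat ^ 'n::finite \<Rightarrow> 'k::field. finite (weight u ` supp f)} mfps_ring"
  by (rule finite_image_supp_subring) (rule weight_add)

lemma series_ring_cring:
  assumes "subring K (mfps_ring :: (nat ^ 'n::finite \<Rightarrow> 'k::field) ring)"
  shows "cring (series_ring K)"
proof -
  interpret cring "mfps_ring :: (nat ^ 'n \<Rightarrow> 'k) ring" by (rule mfps_cring)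
  show ?thesis
    by (rule subcring_iff[THEN iffD1, OF subringE(1)[OF assms] subcringI'[OF assms]])
qed

lemma times_commute: "f \<star> g = g \<star> f"
proof -
  interpret cring "mfps_ring :: (nat ^ 'a \<Rightarrow> 'b) ring" by (rule mfps_cring)
  show ?thesis by (rule m_comm) (simp_all add: mfps_ring_def)
qed

lemma times_assoc: "(f \<star> g) \<star> h = f \<star> (g \<star> h)"
proof -
  interpret cring "mfps_ring :: (nat ^ 'a \<Rightarrow> 'b) ring" by (rule mfps_cring)
  show ?thesis by (rule m_assoc) (simp_all add: mfps_ring_def)
qed

lemma times_minus_one: "(\<ominus>\<^bsub>mfps_ring\<^esub> \<one>\<^bsub>mfps_ring\<^esub>) \<star> g = (\<lambda>a. - g a)"
proof -
  interpret cring "mfps_ring :: (nat ^ 'a \<Rightarrow> 'b) ring" by (rule mfps_cring)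
  have "(\<ominus>\<^bsub>mfps_ring\<^esub> \<one>\<^bsub>mfps_ring\<^esub>) \<star> g = \<ominus>\<^bsub>mfps_ring\<^esub> g"
    using l_minus[of "\<one>\<^bsub>mfps_ring\<^esub>" g] l_one[of g] by (simp add: mfps_ring_def del: l_minus)
  then show ?thesis by (simp add: mfps_minus)
qed

lemma one_times: "\<one>\<^bsub>mfps_ring\<^esub> \<star> g = g"
proof -
  interpret cring "mfps_ring :: (nat ^ 'a \<Rightarrow> 'b) ring" by (rule mfps_cring)
  show ?thesis by (rule l_one) (simp_all add: mfps_ring_def)
qed

lemma times_add_right: "h \<star> (\<lambda>a. f a + g a) = (\<lambda>a. (h \<star> f) a + (h \<star> g) a)"
  by (simp add: times_apply fun_eq_iff case_prod_unfold distrib_left sum.distrib)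

lemma times_add_left: "(\<lambda>a. f a + g a) \<star> h = (\<lambda>a. (f \<star> h) a + (g \<star> h) a)"
  by (simp add: times_commute[of _ h] times_add_right)

lemma times_zero_right: "h \<star> (\<lambda>a. 0) = (\<lambda>a. 0)"
  by (simp add: times_apply fun_eq_iff case_prod_unfold)

lemma times_sum_right: "h \<star> (\<lambda>a. \<Sum>x\<in>A. f x a) = (\<lambda>a. \<Sum>x\<in>A. (h \<star> f x) a)"
  by (induction A rule: infinite_finite_induct) (simp_all add: times_zero_right times_add_right)

text \<open>
  Closure under additive inverses follows from the last assumption: it is multiplication by \<open>-1 \<in> K\<close>.
\<close>
lemma ideal_seriesI:
  fixes K :: "(nat ^ 'n::finite \<Rightarrow> 'k::field) set"
  assumes K: "subring K mfps_ring" and "M \<subseteq> K" and "(\<lambda>a. 0) \<in> M"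
    and add: "\<And>f g. f \<in> M \<Longrightarrow> g \<in> M \<Longrightarrow> (\<lambda>a. f a + g a) \<in> M"
    and mult: "\<And>h f. h \<in> K \<Longrightarrow> f \<in> M \<Longrightarrow> h \<star> f \<in> M"
  shows "ideal M (series_ring K)"
proof -
  interpret cring "series_ring K" by (rule series_ring_cring[OF K])
  have m1: "\<ominus>\<^bsub>mfps_ring\<^esub> \<one>\<^bsub>mfps_ring\<^esub> \<in> K"
    by (rule subringE(5)[OF K subringE(3)[OF K]])
  have minus: "(\<lambda>a. - f a) \<in> M" if "f \<in> M" for f
    using mult[OF m1 that] by (simp add: times_minus_one)
  show ?thesis
  proof (rule idealI)
    show "subgroup M (add_monoid (series_ring K))"
    proof (rule add.subgroupI)
      fix f assume f: "f \<in> M"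
      have "\<ominus>\<^bsub>series_ring K\<^esub> f = (\<lambda>a. - f a)"
        by (rule minus_equality) (use f minus assms(2) in \<open>auto simp: series_ring_simps\<close>)
      then show "\<ominus>\<^bsub>series_ring K\<^esub> f \<in> M" using minus[OF f] by simp
    qed (use assms(2,3) add in \<open>auto simp: series_ring_simps\<close>)
  next
    show "f \<otimes>\<^bsub>series_ring K\<^esub> h \<in> M" if "f \<in> M" "h \<in> carrier (series_ring K)" for f h
      using mult that by (simp add: times_commute[of f])
  qed (use mult ring_axioms in simp_all)
qed

lemma ideal_series_add:
  "ideal M (series_ring K) \<Longrightarrow> f \<in> M \<Longrightarrow> g \<in> M \<Longrightarrow> (\<lambda>a. f a + g a) \<in> M"
  using additive_subgroup.a_closed[OF ideal.axioms(1), of M "series_ring K" f g]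
  by (simp add: series_ring_simps)

lemma ideal_series_zero: "ideal M (series_ring K) \<Longrightarrow> (\<lambda>a. 0) \<in> M"
  using additive_subgroup.zero_closed[OF ideal.axioms(1), of M "series_ring K"]
  by (simp add: series_ring_simps)

lemma ideal_series_mult:
  "ideal M (series_ring K) \<Longrightarrow> h \<in> K \<Longrightarrow> f \<in> M \<Longrightarrow> h \<star> f \<in> M"
  using ideal.I_l_closed[of M "series_ring K" f h] by simp

lemma ideal_series_subset: "ideal M (series_ring K) \<Longrightarrow> M \<subseteq> K"
  using additive_subgroup.a_subset[OF ideal.axioms(1), of M "series_ring K"] by simp

lemma ideal_series_sum:
  assumes "ideal M (series_ring K)" "\<And>x. x \<in> A \<Longrightarrow> f x \<in> M"
  shows "(\<lambda>a. \<Sum>x\<in>A. f x a) \<in> M"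
  using assms(2)
  by (induction A rule: infinite_finite_induct)
    (auto intro: ideal_series_zero[OF assms(1)] ideal_series_add[OF assms(1)])

lemma Idl_series:
  fixes K :: "(nat ^ 'n::finite \<Rightarrow> 'k::field) set"
  assumes "subring K mfps_ring" "S \<subseteq> K"
  shows Idl_series_ideal: "ideal (Idl\<^bsub>series_ring K\<^esub> S) (series_ring K)"
    and Idl_series_self: "S \<subseteq> Idl\<^bsub>series_ring K\<^esub> S"
    and Idl_series_minimal: "ideal M (series_ring K) \<Longrightarrow> S \<subseteq> M \<Longrightarrow> Idl\<^bsub>series_ring K\<^esub> S \<subseteq> M"
proof -
  interpret cring "series_ring K" by (rule series_ring_cring[OF assms(1)])
  have S: "S \<subseteq> carrier (series_ring K)" using assms(2) by simp
  show "ideal (Idl\<^bsub>series_ring K\<^esub> S) (series_ring K)" by (rule genideal_ideal[OF S])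
  show "S \<subseteq> Idl\<^bsub>series_ring K\<^esub> S" by (rule genideal_self[OF S])
  show "ideal M (series_ring K) \<Longrightarrow> S \<subseteq> M \<Longrightarrow> Idl\<^bsub>series_ring K\<^esub> S \<subseteq> M"
    by (rule genideal_minimal)
qed

text \<open>
  The combinations of the elements of \<open>S\<close> form an ideal that contains \<open>S\<close>.
\<close>
lemma Idl_finite_combination:
  fixes K :: "(nat ^ 'n::finite \<Rightarrow> 'k::field) set"
  assumes K: "subring K mfps_ring" and S: "S \<subseteq> K" "finite S" and h: "h \<in> Idl\<^bsub>series_ring K\<^esub> S"
  obtains c where "\<And>g. g \<in> S \<Longrightarrow> c g \<in> K" "h = (\<lambda>a. \<Sum>g\<in>S. (c g \<star> g) a)"
proof -
  let ?z = "\<lambda>a. 0 :: 'k"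
  have zK: "?z \<in> K" using subringE(2)[OF K] by (simp add: mfps_ring_def)
  have addK: "(\<lambda>a. f a + g a) \<in> K" if "f \<in> K" "g \<in> K" for f g
    using subringE(7)[OF K that] by (simp add: mfps_ring_def)
  have multK: "f \<star> g \<in> K" if "f \<in> K" "g \<in> K" for f g by (rule subringE(6)[OF K that])
  have idK: "ideal K (series_ring K)"
    by (rule ideal_seriesI[OF K subset_refl zK addK multK])
  define M where "M = {\<lambda>a. \<Sum>g\<in>S. (c g \<star> g) a | c. \<forall>g\<in>S. c g \<in> K}"
  have "ideal M (series_ring K)"
  proof (rule ideal_seriesI[OF K])
    show "M \<subseteq> K"
      unfolding M_def using S(1) by (auto intro!: ideal_series_sum[OF idK] multK)
    show "?z \<in> M"
      unfolding M_def
      by (rule CollectI, rule exI[of _ "\<lambda>_. ?z"])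
        (simp add: zK times_commute[of ?z] times_zero_right)
  next
    fix f f' assume "f \<in> M" "f' \<in> M"
    then obtain c c' where "\<forall>g\<in>S. c g \<in> K" "f = (\<lambda>a. \<Sum>g\<in>S. (c g \<star> g) a)"
        "\<forall>g\<in>S. c' g \<in> K" "f' = (\<lambda>a. \<Sum>g\<in>S. (c' g \<star> g) a)"
      unfolding M_def by blast
    then show "(\<lambda>a. f a + f' a) \<in> M"
      unfolding M_def
      by (intro CollectI exI[of _ "\<lambda>g a. c g a + c' g a"])
        (simp add: addK times_add_left sum.distrib)
  next
    fix h f assume "h \<in> K" "f \<in> M"
    then obtain c where "\<forall>g\<in>S. c g \<in> K" "f = (\<lambda>a. \<Sum>g\<in>S. (c g \<star> g) a)"
      unfolding M_def by blast
    then show "h \<star> f \<in> M"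
      unfolding M_def using \<open>h \<in> K\<close>
      by (intro CollectI exI[of _ "\<lambda>g. h \<star> c g"])
        (simp add: multK times_sum_right times_assoc)
  qed
  moreover have "S \<subseteq> M"
  proof
    fix g assume g: "g \<in> S"
    let ?c = "\<lambda>g'. if g' = g then \<one>\<^bsub>mfps_ring\<^esub> else ?z"
    have "(\<Sum>g'\<in>S. (?c g' \<star> g') a) = (\<Sum>g'\<in>S. if g' = g then g a else 0)" for a
      by (rule sum.cong) (simp_all add: one_times times_commute[of ?z] times_zero_right)
    also have "(\<Sum>g'\<in>S. if g' = g then g a else 0) = g a" for a
      using g S(2) by simp
    finally have "g = (\<lambda>a. \<Sum>g'\<in>S. (?c g' \<star> g') a)" by simp
    moreover have "\<forall>g'\<in>S. ?c g' \<in> K" using subringE(3)[OF K] zK by simp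
    ultimately show "g \<in> M" unfolding M_def by (intro CollectI exI[of _ ?c] conjI)
  qed
  ultimately have "h \<in> M" using Idl_series_minimal[OF K S(1)] h by blast
  then show ?thesis using that unfolding M_def by blast
qed

section \<open>The Hilbert basis theorem\<close>

text \<open>
  The ideals generated by finite subsets of \<open>S\<close> are directed by inclusion, so their union is
  an ideal, and it contains \<open>S\<close>.
\<close>
lemma Idl_finite_character:
  fixes K :: "(nat ^ 'n::finite \<Rightarrow> 'k::field) set"
  assumes K: "subring K mfps_ring" and S: "S \<subseteq> K" and P: "finite P" "P \<subseteq> Idl\<^bsub>series_ring K\<^esub> S"
  obtains F where "F \<subseteq> S" "finite F" "P \<subseteq> Idl\<^bsub>series_ring K\<^esub> F"
proof -
  define M where "M = (\<Union>F\<in>{F. F \<subseteq> S \<and> finite F}. Idl\<^bsub>series_ring K\<^esub> F)"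
  have MI: "f \<in> M" if "F \<subseteq> S" "finite F" "f \<in> Idl\<^bsub>series_ring K\<^esub> F" for f F
    using that by (auto simp: M_def)
  have mono: "Idl\<^bsub>series_ring K\<^esub> F \<subseteq> Idl\<^bsub>series_ring K\<^esub> F'" if "F \<subseteq> F'" "F' \<subseteq> S" for F F'
    using Idl_series_minimal[OF K, of F "Idl\<^bsub>series_ring K\<^esub> F'"] Idl_series_ideal[OF K, of F']
      Idl_series_self[OF K, of F'] that S by auto
  have id: "ideal (Idl\<^bsub>series_ring K\<^esub> F) (series_ring K)" if "F \<subseteq> S" for F
    using Idl_series_ideal[OF K] that S by blast
  have "ideal M (series_ring K)"
  proof (rule ideal_seriesI[OF K])
    show "M \<subseteq> K" using ideal_series_subset[OF id] by (auto simp: M_def)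
    show "(\<lambda>a. 0) \<in> M" using ideal_series_zero[OF id[of "{}"]] MI[of "{}"] by simp
  next
    fix f g assume "f \<in> M" "g \<in> M"
    then obtain F G where F: "F \<subseteq> S" "finite F" "f \<in> Idl\<^bsub>series_ring K\<^esub> F"
      and G: "G \<subseteq> S" "finite G" "g \<in> Idl\<^bsub>series_ring K\<^esub> G" by (auto simp: M_def)
    have "f \<in> Idl\<^bsub>series_ring K\<^esub> (F \<union> G)" "g \<in> Idl\<^bsub>series_ring K\<^esub> (F \<union> G)"
      using F G mono[of F "F \<union> G"] mono[of G "F \<union> G"] by auto
    then show "(\<lambda>a. f a + g a) \<in> M"
      using F G by (intro MI[of "F \<union> G"] ideal_series_add[OF id]) auto
  next
    fix h f assume "h \<in> K" "f \<in> M"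
    then show "h \<star> f \<in> M" using ideal_series_mult[OF id] MI by (fastforce simp: M_def)
  qed
  moreover have "S \<subseteq> M"
  proof
    fix g assume "g \<in> S"
    then show "g \<in> M" using MI[of "{g}" g] Idl_series_self[OF K, of "{g}"] S by auto
  qed
  ultimately have "P \<subseteq> M" using Idl_series_minimal[OF K S] P(2) by blast
  then have "\<forall>p\<in>P. \<exists>F. F \<subseteq> S \<and> finite F \<and> p \<in> Idl\<^bsub>series_ring K\<^esub> F" by (auto simp: M_def)
  then obtain F where F: "\<And>p. p \<in> P \<Longrightarrow> F p \<subseteq> S \<and> finite (F p) \<and> p \<in> Idl\<^bsub>series_ring K\<^esub> (F p)"
    by metis
  show ?thesis
  proof (rule that[of "\<Union>p\<in>P. F p"])
    show "P \<subseteq> Idl\<^bsub>series_ring K\<^esub> (\<Union>p\<in>P. F p)"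
      using F mono[of "F p" "\<Union>p\<in>P. F p" for p] by (fastforce simp: subset_iff)
  qed (use F P(1) in auto)
qed

lemma monomial_times:
  fixes g :: "nat ^ 'n::finite \<Rightarrow> 'k::field"
  shows "((\<lambda>a. if a = d then c else 0) \<star> g) (d + b) = c * g b"
proof -
  have "((\<lambda>a. if a = d then c else 0) \<star> g) (d + b) =
      (\<Sum>x\<in>{(p, q). p + q = d + b}. (if fst x = d then c else 0) * g (snd x))"
    by (simp add: times_apply case_prod_unfold)
  also have "\<dots> = (\<Sum>x\<in>{(d, b)}. (if fst x = d then c else 0) * g (snd x))"
    by (rule sum.mono_neutral_right) (auto simp: finite_sum_pairs)
  finally show ?thesis by simp
qed

text \<open>
  By Dickson's lemma there are finitely many elements \<open>G b\<close> of the ideal \<open>N\<close> generated by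
  \<open>S\<close> such that every leading monomial of an element of \<open>N\<close> is a multiple of the leading
  monomial \<open>b\<close> of some \<open>G b\<close>. They generate \<open>N\<close>: subtracting a suitable monomial multiple of
  \<open>G b\<close> from \<open>f \<in> N\<close> lowers the leading monomial, which can happen only finitely often. Each
  \<open>G b\<close> is already a combination of finitely many elements of \<open>S\<close>, so the generators can be
  chosen inside \<open>S\<close>. Generators of a special shape in \<open>S\<close> are thereby kept.
\<close>
theorem hilbert_basis:
  fixes S :: "(nat ^ 'n::finite \<Rightarrow> 'k::field) set"
  assumes S: "S \<subseteq> carrier mpoly_ring"
  obtains F where "F \<subseteq> S" "finite F" "Idl\<^bsub>mpoly_ring\<^esub> F = Idl\<^bsub>mpoly_ring\<^esub> S"
proof -
  let ?K = "{f :: nat ^ 'n \<Rightarrow> 'k. finite (supp f)}"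
  note K = subring_finite_supp[where ?'n = 'n and ?'k = 'k]
  define N where "N = Idl\<^bsub>series_ring ?K\<^esub> S"
  have SK: "S \<subseteq> ?K" using S by (simp add: mpoly_carrier)
  have N: "ideal N (series_ring ?K)" unfolding N_def by (rule Idl_series_ideal[OF K SK])
  have NK: "N \<subseteq> ?K" by (rule ideal_series_subset[OF N])
  obtain r :: "(nat ^ 'n) rel" where r: "wf r" "trans r" "total r"
    "\<And>a b c. (a, b) \<in> r \<Longrightarrow> (c + a, c + b) \<in> r"
    using monomial_order_exists by blast
  define lead where "lead f a \<longleftrightarrow> a \<in> supp f \<and> (\<forall>b\<in>supp f. b = a \<or> (b, a) \<in> r)"
    for f :: "nat ^ 'n \<Rightarrow> 'k" and a
  obtain B where B: "B \<subseteq> {a. \<exists>f\<in>N. lead f a}" "finite B"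
    "\<And>a. a \<in> {a. \<exists>f\<in>N. lead f a} \<Longrightarrow> \<exists>b\<in>B. b \<le> a"
    using dickson by blast
  have "\<forall>b\<in>B. \<exists>g. g \<in> N \<and> lead g b" using B(1) by blast
  then obtain G where G: "\<And>b. b \<in> B \<Longrightarrow> G b \<in> N \<and> lead (G b) b" by metis
  define M where "M = Idl\<^bsub>series_ring ?K\<^esub> (G ` B)"
  have GK: "G ` B \<subseteq> ?K" using G NK by auto
  have M: "ideal M (series_ring ?K)" unfolding M_def by (rule Idl_series_ideal[OF K GK])
  have GM: "G b \<in> M" if "b \<in> B" for b
    using Idl_series_self[OF K GK] that by (auto simp: M_def)
  have main: "f \<in> M" if "f \<in> N" "lead f a" for f a
    using r(1) that
  proof (induction a arbitrary: f)
    case (less a)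
    obtain b where b: "b \<in> B" "b \<le> a" using B(3) less.prems by blast
    define d where "d = a - b"
    have a: "a = d + b" using b(2) by (auto simp: d_def vec_eq_iff less_eq_vec_def)
    (* With this coefficient, subtracting c x^d (G b) cancels the leading term of f. *)
    define c where "c = f a / G b b"
    define t where "t = (\<lambda>x. if x = d then c else 0) \<star> G b"
    have mono: "(\<lambda>x. if x = d then c' else 0) \<in> ?K" for c'
      by (rule CollectI, rule finite_subset[of _ "{d}"]) (auto simp: supp_def)
    have tM: "t \<in> M" unfolding t_def by (rule ideal_series_mult[OF M mono GM[OF b(1)]])
    have negN: "(\<lambda>x. - t x) \<in> N"
    proof -
      have "(\<lambda>x. - t x) = (\<lambda>x. if x = d then - c else 0) \<star> G b"
        unfolding t_def by (auto simp: times_apply fun_eq_iff sum_negf[symmetric] intro!: sum.cong)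
      then show ?thesis using ideal_series_mult[OF N mono] G b(1) by simp
    qed
    define h where "h = (\<lambda>x. f x + - t x)"
    have hN: "h \<in> N" unfolding h_def by (rule ideal_series_add[OF N less.prems(1) negN])
    have Gb: "b \<in> supp (G b)" "\<And>x. x \<in> supp (G b) \<Longrightarrow> x = b \<or> (x, b) \<in> r"
      using G[OF b(1)] by (auto simp: lead_def)
    have "t a = f a" unfolding t_def a monomial_times using Gb(1) by (simp add: c_def a supp_def)
    then have ha: "h a = 0" by (simp add: h_def)
    have t_le: "x = a \<or> (x, a) \<in> r" if x: "x \<in> supp t" for x
    proof -
      obtain p q where pq: "p \<in> supp (\<lambda>x. if x = d then c else 0)" "q \<in> supp (G b)" "x = p + q"
        using x supp_mult_subset unfolding t_def by fastforce
      have "p = d" using pq(1) by (auto simp: supp_def split: if_splits)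
      then show ?thesis using Gb(2)[OF pq(2)] r(4)[of q b d] pq(3) a by auto
    qed
    have h_lt: "(x, a) \<in> r" if x: "x \<in> supp h" for x
    proof -
      have "x \<in> supp f \<or> x \<in> supp t" using x by (auto simp: supp_def h_def)
      moreover have "x \<noteq> a" using x ha by (auto simp: supp_def)
      ultimately show ?thesis using t_le less.prems(2) by (auto simp: lead_def)
    qed
    have "h \<in> M"
    proof (cases "supp h = {}")
      case True
      then have "h = (\<lambda>a. 0)" by (auto simp: supp_def)
      then show ?thesis using ideal_series_zero[OF M] by simp
    next
      case False
      moreover have "finite (supp h)" using hN NK by auto
      ultimately obtain a' where "a' \<in> supp h" "\<And>x. x \<in> supp h \<Longrightarrow> x = a' \<or> (x, a') \<in> r"
        using finite_has_greatest[OF r(2,3)] by metis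
      then show ?thesis using less.IH[of a' h] h_lt hN by (auto simp: lead_def)
    qed
    then have "(\<lambda>x. h x + t x) \<in> M" by (rule ideal_series_add[OF M _ tM])
    then show ?case by (simp add: h_def)
  qed
  have NM: "N \<subseteq> M"
  proof
    fix f assume f: "f \<in> N"
    show "f \<in> M"
    proof (cases "supp f = {}")
      case True
      then have "f = (\<lambda>a. 0)" by (auto simp: supp_def)
      then show ?thesis using ideal_series_zero[OF M] by simp
    next
      case False
      moreover have "finite (supp f)" using f NK by auto
      ultimately obtain a where "a \<in> supp f" "\<And>x. x \<in> supp f \<Longrightarrow> x = a \<or> (x, a) \<in> r"
        using finite_has_greatest[OF r(2,3)] by metis
      then show ?thesis using main[of f a] f by (auto simp: lead_def)
    qed
  qed
  have "finite (G ` B)" "G ` B \<subseteq> Idl\<^bsub>series_ring ?K\<^esub> S" using B(2) G by (auto simp: N_def)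
  from Idl_finite_character[OF K SK this]
  obtain F where F: "F \<subseteq> S" "finite F" "G ` B \<subseteq> Idl\<^bsub>series_ring ?K\<^esub> F" by blast
  have FK: "F \<subseteq> ?K" using F(1) SK by blast
  have "M \<subseteq> Idl\<^bsub>series_ring ?K\<^esub> F"
    unfolding M_def by (rule Idl_series_minimal[OF K GK Idl_series_ideal[OF K FK] F(3)])
  moreover have "Idl\<^bsub>series_ring ?K\<^esub> F \<subseteq> N"
    by (rule Idl_series_minimal[OF K FK N]) (use F(1) Idl_series_self[OF K SK] in \<open>auto simp: N_def\<close>)
  ultimately have "Idl\<^bsub>series_ring ?K\<^esub> F = N" using NM by blast
  then show ?thesis using that F(1,2) by (simp add: mpoly_ring_eq N_def)
qed

section \<open>Homogeneous components\<close>

definition mdeg :: "nat ^ 'n::finite \<Rightarrow> nat ^ 'n \<Rightarrow> nat" where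
  "mdeg \<alpha> a = (\<Sum>i\<in>UNIV. \<alpha> $ i * a $ i)"

definition hcomp :: "nat ^ 'n::finite \<Rightarrow> nat \<Rightarrow> (nat ^ 'n \<Rightarrow> 'k::zero) \<Rightarrow> nat ^ 'n \<Rightarrow> 'k" where
  "hcomp \<alpha> d f = (\<lambda>a. if mdeg \<alpha> a = d then f a else 0)"

lemma mdeg_add: "mdeg \<alpha> (b + c) = mdeg \<alpha> b + mdeg \<alpha> c"
  by (simp add: mdeg_def distrib_left sum.distrib)

text \<open>
  Positivity of \<open>\<alpha>\<close> enters here: \<open>\<alpha>\<close>-degree \<open>d\<close> forces every exponent to be at most
  \<open>d\<close>, so the components of a power series are polynomials.
\<close>
lemma finite_supp_hcomp:
  assumes "\<forall>i. \<alpha> $ i > 0"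
  shows "finite (supp (hcomp \<alpha> d f))"
proof (rule finite_subset[OF _ finite_vec_le[of "\<lambda>_. d"]])
  show "supp (hcomp \<alpha> d f) \<subseteq> {b. \<forall>i. b $ i \<le> d}"
  proof clarify
    fix a i assume "a \<in> supp (hcomp \<alpha> d f)"
    then have d: "mdeg \<alpha> a = d" by (auto simp: supp_def hcomp_def split: if_splits)
    have "a $ i \<le> \<alpha> $ i * a $ i" using assms by (simp add: Suc_le_eq)
    also have "\<dots> \<le> mdeg \<alpha> a" unfolding mdeg_def by (rule member_le_sum) auto
    finally show "a $ i \<le> d" using d by simp
  qed
qed

lemma hcomp_times:
  fixes h f :: "nat ^ 'n::finite \<Rightarrow> 'k::field"
  shows "hcomp \<alpha> d (h \<star> f) = (\<lambda>a. \<Sum>e\<le>d. (hcomp \<alpha> (d - e) h \<star> hcomp \<alpha> e f) a)"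
proof
  fix a :: "nat ^ 'n"
  let ?P = "{(b, c). b + c = a}"
  have inner: "(\<Sum>e\<le>d. hcomp \<alpha> (d - e) h b * hcomp \<alpha> e f c) =
      (if mdeg \<alpha> a = d then h b * f c else 0)" if "b + c = a" for b c :: "nat ^ 'n"
  proof -
    have "(\<Sum>e\<le>d. hcomp \<alpha> (d - e) h b * hcomp \<alpha> e f c) =
        (\<Sum>e\<le>d. if e = mdeg \<alpha> c then (if mdeg \<alpha> a = d then h b * f c else 0) else 0)"
      using that by (intro sum.cong) (auto simp: hcomp_def mdeg_add)
    also have "\<dots> = (if mdeg \<alpha> a = d then h b * f c else 0)"
      using that by (auto simp: mdeg_add)
    finally show ?thesis .
  qed
  have "(\<Sum>e\<le>d. (hcomp \<alpha> (d - e) h \<star> hcomp \<alpha> e f) a) =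
      (\<Sum>x\<in>?P. \<Sum>e\<le>d. hcomp \<alpha> (d - e) h (fst x) * hcomp \<alpha> e f (snd x))"
    by (simp add: times_apply case_prod_unfold) (rule sum.swap)
  also have "\<dots> = (\<Sum>x\<in>?P. if mdeg \<alpha> a = d then h (fst x) * f (snd x) else 0)"
    using inner by (intro sum.cong) auto
  also have "\<dots> = hcomp \<alpha> d (h \<star> f) a"
    by (simp add: hcomp_def times_apply case_prod_unfold)
  finally show "hcomp \<alpha> d (h \<star> f) a = (\<Sum>e\<le>d. (hcomp \<alpha> (d - e) h \<star> hcomp \<alpha> e f) a)" by simp
qed

text \<open>
  A component of a product \<open>h \<star> f\<close> is a finite sum of components of \<open>f\<close> with polynomial
  coefficients, namely components of \<open>h\<close>. So multiplication by an arbitrary power series does not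
  lead out of the hull, although \<open>M\<close> is an ideal of the polynomial ring only.
\<close>
lemma ideal_graded_hull:
  fixes M :: "(nat ^ 'n::finite \<Rightarrow> 'k::field) set"
  assumes \<alpha>: "\<forall>i. \<alpha> $ i > 0" and M: "ideal M mpoly_ring" and K: "subring K mfps_ring"
  shows "ideal {f \<in> K. \<forall>d. hcomp \<alpha> d f \<in> M} (series_ring K)"
proof (rule ideal_seriesI[OF K])
  note M' = M[unfolded mpoly_ring_eq]
  have z: "hcomp \<alpha> d (\<lambda>a. 0 :: 'k) = (\<lambda>a. 0)" for d by (auto simp: hcomp_def)
  show "(\<lambda>a. 0) \<in> {f \<in> K. \<forall>d. hcomp \<alpha> d f \<in> M}"
    using subringE(2)[OF K] ideal_series_zero[OF M'] by (simp add: series_ring_simps z)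
next
  fix f g assume fg: "f \<in> {f \<in> K. \<forall>d. hcomp \<alpha> d f \<in> M}" "g \<in> {f \<in> K. \<forall>d. hcomp \<alpha> d f \<in> M}"
  have "hcomp \<alpha> d (\<lambda>a. f a + g a) = (\<lambda>a. hcomp \<alpha> d f a + hcomp \<alpha> d g a)" for d
    by (auto simp: hcomp_def)
  then show "(\<lambda>a. f a + g a) \<in> {f \<in> K. \<forall>d. hcomp \<alpha> d f \<in> M}"
    using fg subringE(7)[OF K, of f g] ideal_series_add[OF M[unfolded mpoly_ring_eq]]
    by (simp add: series_ring_simps)
next
  fix h f assume hf: "h \<in> K" "f \<in> {f \<in> K. \<forall>d. hcomp \<alpha> d f \<in> M}"
  have "hcomp \<alpha> d (h \<star> f) \<in> M" for d
    unfolding hcomp_times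
    using hf(2) finite_supp_hcomp[OF \<alpha>]
    by (intro ideal_series_sum[OF M[unfolded mpoly_ring_eq]]
        ideal_series_mult[OF M[unfolded mpoly_ring_eq]]) auto
  then show "h \<star> f \<in> {f \<in> K. \<forall>d. hcomp \<alpha> d f \<in> M}"
    using subringE(6)[OF K hf(1)] hf(2) by simp
qed auto

lemma poly_eq_sum_hcomp:
  assumes "finite (supp f)"
  shows "f = (\<lambda>a. \<Sum>d\<in>mdeg \<alpha> ` supp f. hcomp \<alpha> d f a)"
proof
  fix a
  have "(\<Sum>d\<in>mdeg \<alpha> ` supp f. hcomp \<alpha> d f a) =
      (\<Sum>d\<in>mdeg \<alpha> ` supp f. if d = mdeg \<alpha> a then f a else 0)"
    by (rule sum.cong) (auto simp: hcomp_def)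
  also have "\<dots> = f a" using assms by (auto simp: supp_def)
  finally show "f a = (\<Sum>d\<in>mdeg \<alpha> ` supp f. hcomp \<alpha> d f a)" by simp
qed

lemma poly_mem_ideal_if_hcomp_mem:
  fixes M :: "(nat ^ 'n::finite \<Rightarrow> 'k::field) set"
  assumes M: "ideal M mpoly_ring" and f: "finite (supp f)" "\<And>d. hcomp \<alpha> d f \<in> M"
  shows "f \<in> M"
  by (subst poly_eq_sum_hcomp[OF f(1), of \<alpha>])
    (rule ideal_series_sum[OF M[unfolded mpoly_ring_eq] f(2)])

text \<open>
  A homogeneous generator is its own only nonzero component, so the hull of \<open>I\<close> inside the
  polynomial ring contains the generators of \<open>I\<close>.
\<close>
lemma homogeneous_ideal_hcomp_mem:
  fixes I :: "(nat ^ 'n::finite \<Rightarrow> 'k::field) set"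
  assumes \<alpha>: "\<forall>i. \<alpha> $ i > 0" and I: "homogeneous_ideal \<alpha> I" and f: "f \<in> I"
  shows "hcomp \<alpha> d f \<in> I"
proof -
  let ?K = "{f :: nat ^ 'n \<Rightarrow> 'k. finite (supp f)}"
  obtain G where G: "G \<subseteq> ?K" "\<forall>g\<in>G. homogeneous_poly \<alpha> g" "I = Idl\<^bsub>series_ring ?K\<^esub> G"
    using I by (auto simp: homogeneous_ideal_def mpoly_ring_eq)
  have id: "ideal I (series_ring ?K)"
    unfolding G(3) by (rule Idl_series_ideal[OF subring_finite_supp G(1)])
  let ?H = "{f \<in> ?K. \<forall>d. hcomp \<alpha> d f \<in> I}"
  have "G \<subseteq> ?H"
  proof
    fix g assume g: "g \<in> G"
    then obtain e where e: "\<forall>a\<in>supp g. mdeg \<alpha> a = e"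
      using G(2) by (auto simp: homogeneous_poly_def mdeg_def)
    have "hcomp \<alpha> d g = (if d = e then g else (\<lambda>a. 0))" for d
      using e by (auto simp: hcomp_def supp_def fun_eq_iff)
    moreover have "g \<in> I" using Idl_series_self[OF subring_finite_supp G(1)] g G(3) by blast
    ultimately show "g \<in> ?H" using g G(1) ideal_series_zero[OF id] by auto
  qed
  moreover have "ideal ?H (series_ring ?K)"
    by (rule ideal_graded_hull[OF \<alpha> _ subring_finite_supp]) (simp add: id mpoly_ring_eq)
  ultimately have "I \<subseteq> ?H"
    unfolding G(3) by (intro Idl_series_minimal[OF subring_finite_supp G(1)])
  then show ?thesis using f by blast
qed

section \<open>Initial forms\<close>

text \<open>
  The weight of a monomial decreases when the exponents grow, so the weights on the support are
  bounded by those of the finitely many minimal monomials that Dickson's lemma provides, even if the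
  support is infinite.
\<close>
lemma u_ord_greatest:
  fixes f :: "nat ^ 'n::finite \<Rightarrow> 'k::zero"
  assumes u: "u \<in> U_loc" and ne: "supp f \<noteq> {}"
  shows "u_ord u f \<in> weight u ` supp f" "\<And>a. a \<in> supp f \<Longrightarrow> weight u a \<le> u_ord u f"
proof -
  obtain B where B: "B \<subseteq> supp f" "finite B" "\<And>a. a \<in> supp f \<Longrightarrow> \<exists>b\<in>B. b \<le> a"
    using dickson by blast
  have "B \<noteq> {}" using B(3) ne by blast
  define m where "m = Max (weight u ` B)"
  have m: "m \<in> weight u ` B" unfolding m_def using B(2) \<open>B \<noteq> {}\<close> by (intro Max_in) auto
  have max: "weight u a \<le> m" if a: "a \<in> supp f" for a
  proof -
    obtain b where b: "b \<in> B" "b \<le> a" using B(3)[OF a] by blast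
    have "weight u a \<le> weight u b"
      unfolding weight_def using u b(2)
      by (intro sum_mono mult_left_mono_neg) (auto simp: U_loc_def less_eq_vec_def)
    also have "\<dots> \<le> m" unfolding m_def using B(2) b(1) by simp
    finally show ?thesis .
  qed
  have "u_ord u f = m"
    unfolding u_ord_def by (rule Greatest_equality) (use m max B(1) in auto)
  then show "u_ord u f \<in> weight u ` supp f" "\<And>a. a \<in> supp f \<Longrightarrow> weight u a \<le> u_ord u f"
    using m max B(1) by auto
qed

lemma supp_in_form: "supp (in_form u f) \<subseteq> {a \<in> supp f. weight u a = u_ord u f}"
  by (auto simp: supp_def in_form_def split: if_splits)

lemma in_form_poly: "finite (supp f) \<Longrightarrow> finite (supp (in_form u f))"
  using supp_in_form by (metis (no_types, lifting) finite_subset mem_Collect_eq subsetI subset_iff)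

lemma in_form_gr: "in_form u f \<in> {f. finite (weight u ` supp f)}"
proof -
  have "weight u ` supp (in_form u f) \<subseteq> {u_ord u f}" using supp_in_form by blast
  then show ?thesis using finite_subset by blast
qed

text \<open>
  If some monomial of degree \<open>d\<close> attains the maximal weight on the support of \<open>f\<close>, then that
  weight is also the maximum over the monomials of degree \<open>d\<close>. Otherwise the component of the
  initial form vanishes.
\<close>
lemma hcomp_in_form:
  fixes f :: "nat ^ 'n::finite \<Rightarrow> 'k::field"
  assumes u: "u \<in> U_loc"
  shows "hcomp \<alpha> d (in_form u f) = (\<lambda>a. 0) \<or> hcomp \<alpha> d (in_form u f) = in_form u (hcomp \<alpha> d f)"
proof (cases "hcomp \<alpha> d (in_form u f) = (\<lambda>a. 0)")
  case False
  then obtain a where a: "mdeg \<alpha> a = d" "a \<in> supp f" "weight u a = u_ord u f"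
    by (auto simp: hcomp_def in_form_def fun_eq_iff split: if_splits)
  have sub: "supp (hcomp \<alpha> d f) = {b \<in> supp f. mdeg \<alpha> b = d}" by (auto simp: supp_def hcomp_def)
  have "u_ord u (hcomp \<alpha> d f) = u_ord u f"
    unfolding u_ord_def[of u "hcomp \<alpha> d f"]
  proof (rule Greatest_equality)
    show "u_ord u f \<in> weight u ` supp (hcomp \<alpha> d f)"
      unfolding sub using a by (intro image_eqI[of _ _ a]) auto
    show "y \<le> u_ord u f" if "y \<in> weight u ` supp (hcomp \<alpha> d f)" for y
      using that u_ord_greatest(2)[OF u] a(2) unfolding sub by blast
  qed
  then have "hcomp \<alpha> d (in_form u f) = in_form u (hcomp \<alpha> d f)"
    by (auto simp: hcomp_def in_form_def supp_def fun_eq_iff)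
  then show ?thesis by blast
qed simp

section \<open>Initial ideals of the polynomial ideal and of its extension\<close>

lemma in_ideal_mpoly:
  fixes I :: "(nat ^ 'n::finite \<Rightarrow> 'k::field) set"
  assumes "I \<subseteq> carrier mpoly_ring"
  shows "ideal (in_ideal mpoly_ring u I) mpoly_ring"
    and "f \<in> I \<Longrightarrow> in_form u f \<in> in_ideal mpoly_ring u I"
proof -
  have s: "in_form u ` I \<subseteq> {f. finite (supp f)}"
    using assms in_form_poly by (auto simp: mpoly_carrier)
  show "ideal (in_ideal mpoly_ring u I) mpoly_ring"
    unfolding in_ideal_def gr_mpoly
    unfolding mpoly_ring_eq by (rule Idl_series_ideal[OF subring_finite_supp s])
  show "in_form u f \<in> in_ideal mpoly_ring u I" if "f \<in> I"
    unfolding in_ideal_def gr_mpoly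
    unfolding mpoly_ring_eq using Idl_series_self[OF subring_finite_supp s] that by blast
qed

lemma in_ideal_mfps:
  fixes J :: "(nat ^ 'n::finite \<Rightarrow> 'k::field) set"
  shows "ideal (in_ideal mfps_ring u J) (gr_ring mfps_ring u)"
    and "f \<in> J \<Longrightarrow> in_form u f \<in> in_ideal mfps_ring u J"
proof -
  have s: "in_form u ` J \<subseteq> {f. finite (weight u ` supp f)}" using in_form_gr by blast
  show "ideal (in_ideal mfps_ring u J) (gr_ring mfps_ring u)"
    unfolding in_ideal_def gr_mfps_eq by (rule Idl_series_ideal[OF subring_gr s])
  show "in_form u f \<in> in_ideal mfps_ring u J" if "f \<in> J"
    unfolding in_ideal_def gr_mfps_eq using Idl_series_self[OF subring_gr s] that by blast
qed

lemma hcomp_extension_mem: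
  fixes I :: "(nat ^ 'n::finite \<Rightarrow> 'k::field) set"
  assumes \<alpha>: "\<forall>i. \<alpha> $ i > 0" and I: "ideal I mpoly_ring" and hom: "homogeneous_ideal \<alpha> I"
    and f: "f \<in> Idl\<^bsub>mfps_ring\<^esub> I"
  shows "hcomp \<alpha> d f \<in> I"
proof -
  have "Idl\<^bsub>series_ring UNIV\<^esub> I \<subseteq> {f \<in> UNIV. \<forall>d. hcomp \<alpha> d f \<in> I}"
    by (rule Idl_series_minimal[OF subring_UNIV subset_UNIV ideal_graded_hull[OF \<alpha> I subring_UNIV]])
      (use homogeneous_ideal_hcomp_mem[OF \<alpha> hom] in auto)
  then show ?thesis using f by (auto simp: mfps_ring_eq[symmetric])
qed

lemma hcomp_in_form_extension_mem:
  fixes I :: "(nat ^ 'n::finite \<Rightarrow> 'k::field) set"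
  assumes \<alpha>: "\<forall>i. \<alpha> $ i > 0" and I: "ideal I mpoly_ring" and hom: "homogeneous_ideal \<alpha> I"
    and u: "u \<in> U_loc" and f: "f \<in> Idl\<^bsub>mfps_ring\<^esub> I"
  shows "hcomp \<alpha> d (in_form u f) \<in> in_ideal mpoly_ring u I"
proof -
  have IK: "I \<subseteq> carrier mpoly_ring"
    using ideal_series_subset[OF I[unfolded mpoly_ring_eq]] by (simp add: mpoly_carrier)
  have z: "(\<lambda>a. 0) \<in> in_ideal mpoly_ring u I"
    by (rule ideal_series_zero[OF in_ideal_mpoly(1)[OF IK, unfolded mpoly_ring_eq], folded mpoly_ring_eq])
  show ?thesis
    using hcomp_in_form[OF u, of \<alpha> d f]
  proof
    assume "hcomp \<alpha> d (in_form u f) = (\<lambda>a. 0)"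
    then show ?thesis using z by simp
  next
    assume "hcomp \<alpha> d (in_form u f) = in_form u (hcomp \<alpha> d f)"
    then show ?thesis using in_ideal_mpoly(2)[OF IK hcomp_extension_mem[OF \<alpha> I hom f]] by simp
  qed
qed

text \<open>
  The graded hull of \<open>in\<^sub>u(I)\<close> contains the initial forms of the elements of \<open>J\<close>, hence all of
  \<open>in\<^sub>u(J)\<close>, and a polynomial in that hull is a finite sum of elements of \<open>in\<^sub>u(I)\<close>.
\<close>
theorem in_ideal_extension_Int_mpoly:
  fixes I :: "(nat ^ 'n::finite \<Rightarrow> 'k::field) set"
  assumes \<alpha>: "\<forall>i. \<alpha> $ i > 0" and I: "ideal I mpoly_ring" and hom: "homogeneous_ideal \<alpha> I"
    and u: "u \<in> U_loc"
  shows "in_ideal mfps_ring u (Idl\<^bsub>mfps_ring\<^esub> I) \<inter> carrier mpoly_ring = in_ideal mpoly_ring u I"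
proof
  let ?J = "Idl\<^bsub>mfps_ring\<^esub> I"
  let ?M = "in_ideal mpoly_ring u I" and ?N = "in_ideal mfps_ring u ?J"
  let ?P = "{f :: nat ^ 'n \<Rightarrow> 'k. finite (supp f)}"
  let ?K = "{f :: nat ^ 'n \<Rightarrow> 'k. finite (weight u ` supp f)}"
  have IK: "I \<subseteq> carrier mpoly_ring"
    using ideal_series_subset[OF I[unfolded mpoly_ring_eq]] by (simp add: mpoly_carrier)
  note M = in_ideal_mpoly(1)[OF IK, of u]
  have s: "in_form u ` ?J \<subseteq> ?K" using in_form_gr by blast
  have "?N \<subseteq> {f \<in> ?K. \<forall>d. hcomp \<alpha> d f \<in> ?M}"
    unfolding in_ideal_def[of mfps_ring] gr_mfps_eq
    by (rule Idl_series_minimal[OF subring_gr s ideal_graded_hull[OF \<alpha> M subring_gr]])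
      (use s hcomp_in_form_extension_mem[OF \<alpha> I hom u] in auto)
  then show "?N \<inter> carrier mpoly_ring \<subseteq> ?M"
    using poly_mem_ideal_if_hcomp_mem[OF M, where \<alpha> = \<alpha>] by (auto simp: mpoly_carrier subset_iff)
  have N: "ideal ?N (series_ring ?K)" using in_ideal_mfps(1)[of u ?J] by (simp add: gr_mfps_eq)
  have IJ: "I \<subseteq> ?J"
    using Idl_series_self[OF subring_UNIV subset_UNIV, of I] by (simp add: mfps_ring_eq[symmetric])
  have PK: "?P \<subseteq> ?K" by auto
  have P: "subring ?P mfps_ring" by (rule subring_finite_supp)
  have sP: "in_form u ` I \<subseteq> ?P" using IK in_form_poly by (auto simp: mpoly_carrier)
  have "ideal (?N \<inter> ?P) (series_ring ?P)"
  proof (rule ideal_seriesI[OF P])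
    show "(\<lambda>a. 0) \<in> ?N \<inter> ?P" using ideal_series_zero[OF N] by (simp add: supp_def)
  next
    fix f g assume "f \<in> ?N \<inter> ?P" "g \<in> ?N \<inter> ?P"
    then show "(\<lambda>a. f a + g a) \<in> ?N \<inter> ?P"
      using ideal_series_add[OF N, of f g] subringE(7)[OF P, of f g]
      by (simp add: series_ring_simps)
  next
    fix h f assume "h \<in> ?P" "f \<in> ?N \<inter> ?P"
    then show "h \<star> f \<in> ?N \<inter> ?P"
      using ideal_series_mult[OF N, of h f] subringE(6)[OF P, of h f] by simp
  qed simp
  moreover have "in_form u ` I \<subseteq> ?N \<inter> ?P" using in_ideal_mfps(2) IJ sP by blast
  ultimately have "?M \<subseteq> ?N \<inter> ?P"
    unfolding in_ideal_def[of mpoly_ring] gr_mpoly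
    unfolding mpoly_ring_eq by (intro Idl_series_minimal[OF P sP])
  then show "?M \<subseteq> ?N \<inter> carrier mpoly_ring" by (simp add: mpoly_carrier)
qed

text \<open>
  For each degree \<open>d\<close> write the component of \<open>f\<close> as a combination of the generators \<open>g\<close>
  with coefficients \<open>c d g\<close>. These need not be homogeneous, but in degree \<open>d\<close> of the
  combination only the terms of \<open>c d g\<close> of degree \<open>d - D g\<close> are visible. Collecting these
  terms for all \<open>d\<close> gives one power series for each \<open>g\<close>. Only its terms of weight
  \<open>m - W g\<close> contribute to the weight \<open>m\<close> of \<open>f\<close>; dropping all the others makes it an element of
  the graded ring.
\<close>
lemma bihomogeneous_gluing:
  fixes F :: "(nat ^ 'n::finite \<Rightarrow> 'k::field) set"
  assumes F: "finite F" "F \<subseteq> carrier mpoly_ring"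
    and D: "\<And>g a. g \<in> F \<Longrightarrow> a \<in> supp g \<Longrightarrow> mdeg \<alpha> a = D g"
    and W: "\<And>g a. g \<in> F \<Longrightarrow> a \<in> supp g \<Longrightarrow> weight u a = W g"
    and m: "\<And>a. a \<in> supp f \<Longrightarrow> weight u a = m"
    and f: "\<And>d. hcomp \<alpha> d f \<in> Idl\<^bsub>mpoly_ring\<^esub> F"
  shows "f \<in> Idl\<^bsub>gr_ring mfps_ring u\<^esub> F"
proof -
  let ?P = "{f :: nat ^ 'n \<Rightarrow> 'k. finite (supp f)}"
  let ?K = "{f :: nat ^ 'n \<Rightarrow> 'k. finite (weight u ` supp f)}"
  have FP: "F \<subseteq> ?P" using F(2) by (simp add: mpoly_carrier)
  have FK: "F \<subseteq> ?K" using FP by auto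
  have "\<exists>c. hcomp \<alpha> d f = (\<lambda>a. \<Sum>g\<in>F. (c g \<star> g) a)" for d
  proof -
    obtain c where "hcomp \<alpha> d f = (\<lambda>a. \<Sum>g\<in>F. (c g \<star> g) a)"
      using Idl_finite_combination[OF subring_finite_supp FP F(1) f[of d, unfolded mpoly_ring_eq]] .
    then show ?thesis by blast
  qed
  then have "\<forall>d. \<exists>c. hcomp \<alpha> d f = (\<lambda>a. \<Sum>g\<in>F. (c g \<star> g) a)" by (rule allI)
  from choice[OF this] obtain c
    where c: "\<And>d. hcomp \<alpha> d f = (\<lambda>a. \<Sum>g\<in>F. (c d g \<star> g) a)" by (elim exE) (rule that, rule spec)
  define C where "C g b = (if weight u b = m - W g then c (mdeg \<alpha> b + D g) g b else 0)" for g b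
  have C_times: "(C g \<star> g) a = (if weight u a = m then (c (mdeg \<alpha> a) g \<star> g) a else 0)"
    if g: "g \<in> F" for g a
  proof -
    have "C g b * g q = (if weight u a = m then c (mdeg \<alpha> a) g b * g q else 0)"
      if "b + q = a" for b q
    proof (cases "q \<in> supp g")
      case True
      have "mdeg \<alpha> a = mdeg \<alpha> b + D g" "weight u b = m - W g \<longleftrightarrow> weight u a = m"
        unfolding that[symmetric] mdeg_add weight_add D[OF g True] W[OF g True] by auto
      then show ?thesis by (simp add: C_def)
    qed (simp add: supp_def)
    then have "(C g \<star> g) a = (\<Sum>x\<in>{(b, q). b + q = a}.
        if weight u a = m then c (mdeg \<alpha> a) g (fst x) * g (snd x) else 0)"
      unfolding times_apply by (intro sum.cong) auto
    then show ?thesis by (simp add: times_apply case_prod_unfold)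
  qed
  have "f = (\<lambda>a. \<Sum>g\<in>F. (C g \<star> g) a)"
  proof
    fix a
    show "f a = (\<Sum>g\<in>F. (C g \<star> g) a)"
    proof (cases "weight u a = m")
      case True
      then have "(\<Sum>g\<in>F. (C g \<star> g) a) = hcomp \<alpha> (mdeg \<alpha> a) f a"
        unfolding c by (intro sum.cong) (simp_all add: C_times)
      then show ?thesis by (simp add: hcomp_def)
    next
      case False
      then have "f a = 0" using m by (auto simp: supp_def)
      then show ?thesis using False by (simp add: C_times)
    qed
  qed
  moreover have CK: "C g \<in> ?K" for g
  proof -
    have "weight u ` supp (C g) \<subseteq> {m - W g}" by (auto simp: supp_def C_def split: if_splits)
    then show ?thesis using finite_subset by blast
  qed
  moreover note id = Idl_series_ideal[OF subring_gr FK]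
  have "(\<lambda>a. \<Sum>g\<in>F. (C g \<star> g) a) \<in> Idl\<^bsub>series_ring ?K\<^esub> F"
    by (rule ideal_series_sum[OF id ideal_series_mult[OF id CK]])
      (use Idl_series_self[OF subring_gr FK] in blast)
  ultimately show ?thesis unfolding gr_mfps_eq by simp
qed

text \<open>
  The components of initial forms of elements of \<open>I\<close> are homogeneous for \<open>\<alpha>\<close> and for \<open>u\<close>,
  lie in \<open>in\<^sub>u(I)\<close> and generate it, so finitely many such bihomogeneous polynomials generate
  \<open>in\<^sub>u(I)\<close>. Gluing applies to them and to each initial form \<open>in\<^sub>u(f)\<close>, \<open>f \<in> J\<close>.
\<close>
theorem in_ideal_extension_eq_Idl:
  fixes I :: "(nat ^ 'n::finite \<Rightarrow> 'k::field) set"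
  assumes \<alpha>: "\<forall>i. \<alpha> $ i > 0" and I: "ideal I mpoly_ring" and hom: "homogeneous_ideal \<alpha> I"
    and u: "u \<in> U_loc"
  shows "in_ideal mfps_ring u (Idl\<^bsub>mfps_ring\<^esub> I) =
    Idl\<^bsub>gr_ring mfps_ring u\<^esub> (in_ideal mpoly_ring u I)"
proof
  let ?J = "Idl\<^bsub>mfps_ring\<^esub> I"
  let ?M = "in_ideal mpoly_ring u I" and ?N = "in_ideal mfps_ring u ?J"
  let ?P = "{f :: nat ^ 'n \<Rightarrow> 'k. finite (supp f)}"
  let ?K = "{f :: nat ^ 'n \<Rightarrow> 'k. finite (weight u ` supp f)}"
  have IP: "I \<subseteq> ?P" by (rule ideal_series_subset[OF I[unfolded mpoly_ring_eq]])
  then have IK: "I \<subseteq> carrier mpoly_ring" by (simp add: mpoly_carrier)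
  note M = in_ideal_mpoly(1)[OF IK, of u]
  have MP: "?M \<subseteq> ?P" by (rule ideal_series_subset[OF M[unfolded mpoly_ring_eq], folded mpoly_ring_eq])
  have MK: "?M \<subseteq> ?K" using MP by auto
  have N: "ideal ?N (series_ring ?K)" using in_ideal_mfps(1)[of u ?J] by (simp add: gr_mfps_eq)
  have "?M \<subseteq> ?N" using in_ideal_extension_Int_mpoly[OF \<alpha> I hom u] by blast
  then show "Idl\<^bsub>gr_ring mfps_ring u\<^esub> ?M \<subseteq> ?N"
    unfolding gr_mfps_eq by (rule Idl_series_minimal[OF subring_gr MK N])
  define S where "S = {p \<in> ?M. (\<exists>e. \<forall>a\<in>supp p. mdeg \<alpha> a = e) \<and> (\<exists>w. \<forall>a\<in>supp p. weight u a = w)}"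
  have SM: "S \<subseteq> ?M" by (auto simp: S_def)
  have SP: "S \<subseteq> ?P" using SM MP by blast
  have "I \<subseteq> ?J"
    using Idl_series_self[OF subring_UNIV subset_UNIV, of I] by (simp add: mfps_ring_eq[symmetric])
  have "in_form u ` I \<subseteq> Idl\<^bsub>mpoly_ring\<^esub> S"
  proof clarify
    fix f assume f: "f \<in> I"
    have "hcomp \<alpha> d (in_form u f) \<in> S" for d
      unfolding S_def
    proof (intro CollectI conjI)
      show "hcomp \<alpha> d (in_form u f) \<in> ?M"
        using hcomp_in_form_extension_mem[OF \<alpha> I hom u] f \<open>I \<subseteq> ?J\<close> by blast
      show "\<exists>e. \<forall>a\<in>supp (hcomp \<alpha> d (in_form u f)). mdeg \<alpha> a = e"
        by (rule exI[of _ d]) (auto simp: supp_def hcomp_def split: if_splits)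
      show "\<exists>w. \<forall>a\<in>supp (hcomp \<alpha> d (in_form u f)). weight u a = w"
        by (rule exI[of _ "u_ord u f"]) (auto simp: supp_def hcomp_def in_form_def split: if_splits)
    qed
    then have "hcomp \<alpha> d (in_form u f) \<in> Idl\<^bsub>mpoly_ring\<^esub> S" for d
      unfolding mpoly_ring_eq using Idl_series_self[OF subring_finite_supp SP] by blast
    moreover have "ideal (Idl\<^bsub>mpoly_ring\<^esub> S) mpoly_ring"
      unfolding mpoly_ring_eq by (rule Idl_series_ideal[OF subring_finite_supp SP])
    ultimately show "in_form u f \<in> Idl\<^bsub>mpoly_ring\<^esub> S"
      using poly_mem_ideal_if_hcomp_mem in_form_poly f IP by blast
  qed
  then have MS: "?M \<subseteq> Idl\<^bsub>mpoly_ring\<^esub> S"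
    unfolding in_ideal_def[of mpoly_ring] gr_mpoly
    unfolding mpoly_ring_eq
    using IP in_form_poly
    by (intro Idl_series_minimal[OF subring_finite_supp _ Idl_series_ideal[OF subring_finite_supp SP]]) auto
  obtain F where F: "F \<subseteq> S" "finite F" "Idl\<^bsub>mpoly_ring\<^esub> F = Idl\<^bsub>mpoly_ring\<^esub> S"
    using hilbert_basis[of S] SP by (auto simp: mpoly_carrier)
  have FK: "F \<subseteq> ?K" using F(1) SM MK by blast
  have "\<forall>g\<in>F. \<exists>e w. \<forall>a\<in>supp g. mdeg \<alpha> a = e \<and> weight u a = w"
    using F(1) unfolding S_def by blast
  then obtain D W where DW: "\<And>g a. g \<in> F \<Longrightarrow> a \<in> supp g \<Longrightarrow> mdeg \<alpha> a = D g \<and> weight u a = W g"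
    by metis
  have "in_form u ` ?J \<subseteq> Idl\<^bsub>gr_ring mfps_ring u\<^esub> F"
  proof clarify
    fix f assume f: "f \<in> ?J"
    show "in_form u f \<in> Idl\<^bsub>gr_ring mfps_ring u\<^esub> F"
    proof (rule bihomogeneous_gluing[of F \<alpha> D u W _ "u_ord u f"])
      show "F \<subseteq> carrier mpoly_ring" using F(1) SP by (auto simp: mpoly_carrier)
      show "hcomp \<alpha> d (in_form u f) \<in> Idl\<^bsub>mpoly_ring\<^esub> F" for d
        using hcomp_in_form_extension_mem[OF \<alpha> I hom u f] MS F(3) by blast
    qed (use DW F(2) supp_in_form in \<open>blast+\<close>)
  qed
  moreover have "Idl\<^bsub>gr_ring mfps_ring u\<^esub> F \<subseteq> Idl\<^bsub>gr_ring mfps_ring u\<^esub> ?M"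
    unfolding gr_mfps_eq
    by (rule Idl_series_minimal[OF subring_gr FK Idl_series_ideal[OF subring_gr MK]])
      (use F(1) SM Idl_series_self[OF subring_gr MK] in blast)
  ultimately have "in_form u ` ?J \<subseteq> Idl\<^bsub>gr_ring mfps_ring u\<^esub> ?M" by blast
  moreover have "in_form u ` ?J \<subseteq> ?K" using in_form_gr by blast
  ultimately show "?N \<subseteq> Idl\<^bsub>gr_ring mfps_ring u\<^esub> ?M"
    unfolding in_ideal_def[of mfps_ring] gr_mfps_eq
    using Idl_series_minimal[OF subring_gr _ Idl_series_ideal[OF subring_gr MK]] by blast
qed

section \<open>Equivalence classes\<close>

lemma quotient_Int_common_refinement:
  assumes equiv: "equiv U r" and S: "\<And>u. u \<in> U \<Longrightarrow> \<exists>B\<in>Q. u \<in> B"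
    and s: "\<And>u u'. (u, u') \<in> s \<longleftrightarrow> (u, u') \<in> r \<and> (\<forall>B\<in>Q. u \<in> B \<longleftrightarrow> u' \<in> B)"
    and disj: "\<And>B B'. B \<in> Q \<Longrightarrow> B' \<in> Q \<Longrightarrow> B \<inter> B' \<noteq> {} \<Longrightarrow> B = B'"
  shows "U // s = common_refinement (U // r) Q"
proof -
  have s_class: "s `` {u} = r `` {u} \<inter> B" if "u \<in> B" "B \<in> Q" for u B
  proof -
    have "(\<forall>B'\<in>Q. u \<in> B' \<longleftrightarrow> u' \<in> B') \<longleftrightarrow> u' \<in> B" for u'
      using that disj by blast
    then show ?thesis by (auto simp: s)
  qed
  show ?thesis
  proof (intro equalityI subsetI)
    fix X assume "X \<in> U // s"
    then obtain u where u: "u \<in> U" "X = s `` {u}" by (auto elim: quotientE)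
    obtain B where B: "B \<in> Q" "u \<in> B" using S[OF u(1)] by blast
    have "u \<in> r `` {u} \<inter> B" using B(2) equiv_class_self[OF equiv u(1)] by blast
    then show "X \<in> common_refinement (U // r) Q"
      unfolding common_refinement_def u(2) s_class[OF B(2,1)]
      using quotientI[OF u(1), of r] B(1) by blast
  next
    fix X assume "X \<in> common_refinement (U // r) Q"
    then obtain A B where X: "X = A \<inter> B" "A \<in> U // r" "B \<in> Q" "A \<inter> B \<noteq> {}"
      by (auto simp: common_refinement_def)
    then obtain u where u: "u \<in> A" "u \<in> B" by blast
    have uU: "u \<in> U" using in_quotient_imp_subset[OF equiv X(2)] u(1) by blast
    have "A = r `` {u}"
      using X(2) u(1) equiv_class_eq[OF equiv] by (auto elim!: quotientE)
    then have "X = s `` {u}" using s_class[OF u(2) X(3)] X(1) by simp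
    then show "X \<in> U // s" using quotientI[OF uU] by simp
  qed
qed

theorem theorem5p1p1:
  fixes I :: "(nat ^ 'n::finite \<Rightarrow> 'k::field) set"
  assumes "ideal I mpoly_ring"
    and "\<exists>\<alpha> :: nat ^ 'n. (\<forall>i. \<alpha> $ i > 0) \<and> homogeneous_ideal \<alpha> I"
  shows "in_classes mfps_ring (Idl\<^bsub>mfps_ring\<^esub> I) =
    common_refinement (in_classes mpoly_ring I) strata"
proof -
  let ?J = "Idl\<^bsub>mfps_ring\<^esub> I"
  obtain \<alpha> :: "nat ^ 'n" where \<alpha>: "\<forall>i. \<alpha> $ i > 0" and hom: "homogeneous_ideal \<alpha> I"
    using assms(2) by blast
  note ext = in_ideal_extension_eq_Idl[OF \<alpha> assms(1) hom]
  note int = in_ideal_extension_Int_mpoly[OF \<alpha> assms(1) hom]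
  have key: "(u, u') \<in> in_equiv mfps_ring ?J \<longleftrightarrow> (u, u') \<in> in_equiv mpoly_ring I \<and>
      (\<forall>B\<in>strata. u \<in> B \<longleftrightarrow> u' \<in> B)" for u u'
  proof (cases "u \<in> U_loc \<and> u' \<in> U_loc")
    case True
    then have U: "u \<in> U_loc" "u' \<in> U_loc" by auto
    have "(\<forall>B\<in>strata. u \<in> B \<longleftrightarrow> u' \<in> B) \<longleftrightarrow> {i. u $ i \<noteq> 0} = {i. u' $ i \<noteq> 0}"
      using U by (auto simp: strata_def)
    also have "\<dots> \<longleftrightarrow> gr_ring (mfps_ring :: (nat ^ 'n \<Rightarrow> 'k) ring) u = gr_ring mfps_ring u'"
      by (rule gr_mfps_eq_iff[OF U, symmetric])
    finally have str: "(\<forall>B\<in>strata. u \<in> B \<longleftrightarrow> u' \<in> B) \<longleftrightarrow>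
        gr_ring (mfps_ring :: (nat ^ 'n \<Rightarrow> 'k) ring) u = gr_ring mfps_ring u'" .
    have "in_ideal mfps_ring u ?J = in_ideal mfps_ring u' ?J \<longleftrightarrow>
        in_ideal mpoly_ring u I = in_ideal mpoly_ring u' I"
      if "gr_ring (mfps_ring :: (nat ^ 'n \<Rightarrow> 'k) ring) u = gr_ring mfps_ring u'"
      using ext[OF U(1)] ext[OF U(2)] int[OF U(1)] int[OF U(2)] that by metis
    then show ?thesis unfolding str using U by (auto simp: in_equiv_def gr_mpoly)
  qed (auto simp: in_equiv_def)
  have "equiv U_loc (in_equiv mpoly_ring I)"
    by (rule equivI) (auto simp: in_equiv_def refl_on_def sym_def trans_def)
  then show ?thesis
    unfolding in_classes_def
  proof (rule quotient_Int_common_refinement)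
    show "\<exists>B\<in>strata. u \<in> B" if "u \<in> U_loc" for u :: "real ^ 'n"
      using that by (auto simp: strata_def)
    show "B = B'" if "B \<in> strata" "B' \<in> strata" "B \<inter> B' \<noteq> {}" for B B' :: "(real ^ 'n) set"
      using that by (auto simp: strata_def)
  qed (rule key)
qed

end
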